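(* Consider a linear system $\dot x=Ax+Bu$, $y=Cx$ with $A\in\mathbb{R}^{n\times n}$, $B\in\mathbb{R}^{n\times m}$, $C\in\mathbb{R}^{p\times n}$, $p<n$, and $C$ of full row rank. Let $\lambda_1,\dots,\lambda_r$ be the distinct eigenvalues of $A$, and assume that $\mathcal N\cap\ker B^\top\subseteq\mathrm{Im}\,C^\top$. Then the following statements are equivalent: (i) the system is output controllable; (ii) $\mathrm{Im}\,C^\top\cap\left(\bigoplus_{i=1}^r\left(\ker(\lambda_iI-A^\top)\cap\ker B^\top\right)\right)=\{0\}$; (iii) the matrix $$\begin{bmatrix}\mathrm{diag}\big([\lambda_1I-A\ \ B],\dots,[\lambda_rI-A\ \ B]\big)&\mathbf 1_r\otimes K_C\end{bmatrix}$$ has full row rank, where $K_C\in\mathbb{R}^{n\times(n-p)}$ is such that $\mathrm{Im}\,K_C=\ker C$.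
   Context: Output controllable means that $C[B\ AB\ \cdots\ A^{n-1}B]$ has full row rank $p$. Eigenvalues may be complex; kernels, images, spans and direct sums are then understood as subspaces of $\mathbb{C}^n$. $\mathcal N$ denotes the span of the (ordinary) eigenvectors of $A^\top$ that correspond to non-trivial Jordan chains, i.e. to Jordan chains of $A^\top$ of length at least $2$ (so $\mathcal N=\{0\}$ if $A$ is diagonalizable). $\mathbf 1_r$ is the $r$-dimensional all-ones column vector, $\otimes$ the Kronecker product, $\oplus$ the direct sum of subspaces, and $\mathrm{diag}(A_1,\dots,A_N)$ the block matrix with (possibly rectangular) diagonal blocks $A_1,\dots,A_N$ and zeros elsewhere. *)

theory Defs
  imports
    Complex_Main
    "Jordan_Normal_Form.DL_Rank"
    "Jordan_Normal_Form.Matrix_Kernel"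
    "Jordan_Normal_Form.Spectral_Radius"
begin

abbreviation cmat :: "real mat \<Rightarrow> complex mat" where
  "cmat \<equiv> map_mat complex_of_real"

definition mat_range :: "'a :: comm_ring_1 mat \<Rightarrow> 'a vec set" where
  "mat_range M = (\<lambda>x. M *\<^sub>v x) ` carrier_vec (dim_col M)"

definition full_row_rank :: "'a :: field mat \<Rightarrow> bool" where
  "full_row_rank M \<longleftrightarrow> vec_space.rank (dim_row M) M = dim_row M"

text \<open>The block row \<open>[M\<^sub>1 M\<^sub>2 \<dots>]\<close> of matrices that all have \<open>nr\<close> rows.\<close>

definition block_row :: "nat \<Rightarrow> 'a mat list \<Rightarrow> 'a mat" where
  "block_row nr Ms = mat_of_cols nr (concat (map cols Ms))"

definition kronecker_mat :: "'a :: comm_ring_1 mat \<Rightarrow> 'a mat \<Rightarrow> 'a mat" where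
  "kronecker_mat M K = mat (dim_row M * dim_row K) (dim_col M * dim_col K)
     (\<lambda>(i, j). M $$ (i div dim_row K, j div dim_col K) * K $$ (i mod dim_row K, j mod dim_col K))"

definition ones_col :: "nat \<Rightarrow> 'a :: one mat" where
  "ones_col r = mat r 1 (\<lambda>_. 1)"

definition controllability_mat :: "'a :: field mat \<Rightarrow> 'a mat \<Rightarrow> 'a mat" where
  "controllability_mat A B = block_row (dim_row A) (map (\<lambda>k. (A ^\<^sub>m k) * B) [0..<dim_row A])"

definition output_controllable :: "'a :: field mat \<Rightarrow> 'a mat \<Rightarrow> 'a mat \<Rightarrow> bool" where
  "output_controllable A B C \<longleftrightarrow> full_row_rank (C * controllability_mat A B)"

text \<open>A Jordan chain is listed from its ordinary eigenvector (index \<open>0\<close>) upwards.\<close>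

definition jordan_chain :: "'a :: field mat \<Rightarrow> 'a \<Rightarrow> 'a vec list \<Rightarrow> bool" where
  "jordan_chain M l vs \<longleftrightarrow>
     vs \<noteq> [] \<and> set vs \<subseteq> carrier_vec (dim_row M) \<and> eigenvector M (vs ! 0) l \<and>
     (\<forall>i. Suc i < length vs \<longrightarrow> (M - l \<cdot>\<^sub>m 1\<^sub>m (dim_row M)) *\<^sub>v (vs ! Suc i) = vs ! i)"

definition nontrivial_chain_space :: "'a :: field mat \<Rightarrow> 'a vec set" where
  "nontrivial_chain_space M =
     LinearCombinations.module.span class_ring (module_vec TYPE('a) (dim_row M))
       {vs ! 0 | vs. \<exists>l. jordan_chain M l vs \<and> length vs \<ge> 2}"

definition subspace_sum :: "nat \<Rightarrow> 'i set \<Rightarrow> ('i \<Rightarrow> 'a :: field vec set) \<Rightarrow> 'a vec set" where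
  "subspace_sum n I U = {finsum_vec TYPE('a) n w I | w. w \<in> Pi I U}"

text \<open>Sums of subspaces of eigenspaces for distinct eigenvalues are direct, so for such
  families \<^const>\<open>subspace_sum\<close> is the (internal) direct sum.\<close>

lemma eigenspaces_independent:
  fixes M :: "'a :: field mat"
  assumes "finite I" and M: "M \<in> carrier_mat n n" and "inj_on l I"
    and "\<And>i. i \<in> I \<Longrightarrow> U i \<subseteq> mat_kernel (l i \<cdot>\<^sub>m 1\<^sub>m n - M)"
    and "w \<in> Pi I U" and "finsum_vec TYPE('a) n w I = 0\<^sub>v n" and "i \<in> I"
  shows "w i = 0\<^sub>v n"
proof -
  have key: "\<forall>i\<in>I. w i = 0\<^sub>v n"
    if "finite I" "inj_on l I" "\<forall>i\<in>I. w i \<in> carrier_vec n \<and> M *\<^sub>v w i = l i \<cdot>\<^sub>v w i"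
      "\<forall>k<n. (\<Sum>i\<in>I. w i $ k) = 0" for w
    using that
  proof (induction I arbitrary: w rule: finite_induct)
    case empty
    then show ?case by simp
  next
    case (insert j F)
    have c: "w i \<in> carrier_vec n" and e: "M *\<^sub>v w i = l i \<cdot>\<^sub>v w i" if "i \<in> insert j F" for i
      using insert.prems that by auto
    have s: "(\<Sum>i\<in>insert j F. l i * w i $ k) = 0" if k: "k < n" for k
    proof -
      have "(\<Sum>i\<in>insert j F. l i * w i $ k) = (\<Sum>i\<in>insert j F. (M *\<^sub>v w i) $ k)"
      proof (rule sum.cong[OF refl])
        fix i assume "i \<in> insert j F"
        then show "l i * w i $ k = (M *\<^sub>v w i) $ k" using c[of i] e[of i] k by simp
      qed
      also have "\<dots> = (\<Sum>i\<in>insert j F. \<Sum>q\<in>{0..<n}. M $$ (k, q) * w i $ q)"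
      proof (rule sum.cong[OF refl])
        fix i assume "i \<in> insert j F"
        then have "w i \<in> carrier_vec n" by (rule c)
        then show "(M *\<^sub>v w i) $ k = (\<Sum>q\<in>{0..<n}. M $$ (k, q) * w i $ q)"
          using M k by (simp add: scalar_prod_def)
      qed
      also have "\<dots> = (\<Sum>q\<in>{0..<n}. M $$ (k, q) * (\<Sum>i\<in>insert j F. w i $ q))"
        by (subst sum.swap) (simp add: sum_distrib_left)
      also have "\<dots> = 0" using insert.prems(3) by (auto intro!: sum.neutral)
      finally show ?thesis .
    qed
    define v where "v i = (l j - l i) \<cdot>\<^sub>v w i" for i
    have "\<forall>i\<in>F. v i = 0\<^sub>v n"
    proof (rule insert.IH)
      show "inj_on l F" using insert.prems(1) by (simp add: inj_on_insert)
      show "\<forall>i\<in>F. v i \<in> carrier_vec n \<and> M *\<^sub>v v i = l i \<cdot>\<^sub>v v i"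
        using c e M by (auto simp: v_def mult_mat_vec smult_smult_assoc mult.commute)
      show "\<forall>k<n. (\<Sum>i\<in>F. v i $ k) = 0"
      proof (intro allI impI)
        fix k assume k: "k < n"
        have "(\<Sum>i\<in>F. v i $ k) = (\<Sum>i\<in>insert j F. (l j - l i) * w i $ k)"
        proof -
          have "v i $ k = (l j - l i) * w i $ k" if "i \<in> F" for i
            using c[of i] that k by (simp add: v_def)
          then show ?thesis using insert.hyps by simp
        qed
        also have "\<dots> = l j * (\<Sum>i\<in>insert j F. w i $ k) - (\<Sum>i\<in>insert j F. l i * w i $ k)"
          by (simp only: left_diff_distrib sum_subtractf sum_distrib_left)
        also have "\<dots> = 0" using s[OF k] insert.prems(3) k by simp
        finally show "(\<Sum>i\<in>F. v i $ k) = 0" .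
      qed
    qed
    have F: "w i = 0\<^sub>v n" if "i \<in> F" for i
    proof (rule eq_vecI)
      have "l j \<noteq> l i" using that insert.hyps insert.prems(1) by (auto simp: inj_on_def)
      fix k assume "k < dim_vec (0\<^sub>v n :: 'a vec)"
      then have k: "k < n" by simp
      have "v i $ k = 0" using \<open>\<forall>i\<in>F. v i = 0\<^sub>v n\<close> that k by simp
      moreover have "v i $ k = (l j - l i) * w i $ k" using c[of i] that k by (simp add: v_def)
      ultimately show "w i $ k = 0\<^sub>v n $ k" using \<open>l j \<noteq> l i\<close> k by simp
    qed (use c that in auto)
    have "w j = 0\<^sub>v n"
    proof (rule eq_vecI)
      fix k assume "k < dim_vec (0\<^sub>v n :: 'a vec)"
      then have k: "k < n" by simp
      have "(\<Sum>i\<in>F. w i $ k) = 0" using F k by simp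
      moreover have "w j $ k + (\<Sum>i\<in>F. w i $ k) = 0"
        using insert.prems(3) insert.hyps k by simp
      ultimately show "w j $ k = 0\<^sub>v n $ k" using k by simp
    qed (use c[of j] in auto)
    then show ?case using F by auto
  qed
  have w: "w i \<in> carrier_vec n \<and> M *\<^sub>v w i = l i \<cdot>\<^sub>v w i" if "i \<in> I" for i
  proof -
    have "w i \<in> mat_kernel (l i \<cdot>\<^sub>m 1\<^sub>m n - M)" using assms that by blast
    then have c: "w i \<in> carrier_vec n" and 0: "(l i \<cdot>\<^sub>m 1\<^sub>m n - M) *\<^sub>v w i = 0\<^sub>v n"
      using M by (auto simp: mat_kernel_def)
    have "(l i \<cdot>\<^sub>m 1\<^sub>m n - M) *\<^sub>v w i = (l i \<cdot>\<^sub>m 1\<^sub>m n) *\<^sub>v w i - M *\<^sub>v w i"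
      using c M by (intro minus_mult_distrib_mat_vec[of _ n n]) auto
    also have "(l i \<cdot>\<^sub>m 1\<^sub>m n) *\<^sub>v w i = l i \<cdot>\<^sub>v w i"
      using c by (auto simp: smult_scalar_prod_distrib[of _ n] intro!: eq_vecI)
    finally have d: "l i \<cdot>\<^sub>v w i - M *\<^sub>v w i = 0\<^sub>v n" using 0 by simp
    have "M *\<^sub>v w i = l i \<cdot>\<^sub>v w i"
    proof (rule eq_vecI)
      fix k assume "k < dim_vec (l i \<cdot>\<^sub>v w i)"
      then have k: "k < n" using c by simp
      have "(l i \<cdot>\<^sub>v w i - M *\<^sub>v w i) $ k = 0" using d k by simp
      then show "(M *\<^sub>v w i) $ k = (l i \<cdot>\<^sub>v w i) $ k"
        using k c M by simp
    qed (use c M in auto)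
    with c show ?thesis by simp
  qed
  have "\<forall>k<n. (\<Sum>i\<in>I. w i $ k) = 0"
  proof (intro allI impI)
    fix k assume k: "k < n"
    have "finsum_vec TYPE('a) n w I $ k = (\<Sum>i\<in>I. w i $ k)"
      using w by (intro index_finsum_vec[OF assms(1) k]) auto
    then show "(\<Sum>i\<in>I. w i $ k) = 0" using assms(6) k by simp
  qed
  with key[of w] w assms(1,3,7) show ?thesis by blast
qed

end

theory Submission
  imports Defs
begin

text \<open>Let \<open>W\<close> be the space of vectors \<open>v\<close> with \<open>B\<^sup>T (A\<^sup>T)\<^sup>k v = 0\<close> for all \<open>k < n\<close>; output
  controllability means that \<open>W\<close> meets the image of \<open>C\<^sup>T\<close> only in \<open>0\<close>. The sum of the spaces in (ii)
  consists of the eigenvectors of \<open>A\<^sup>T\<close> in \<open>W\<close> and their sums. If it were smaller than \<open>W\<close>, the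
  restriction of \<open>A\<^sup>T\<close> to \<open>W\<close> would have a Jordan chain of length two; its eigenvector lies in the
  chain space and in the kernel of \<open>B\<^sup>T\<close>, hence by assumption in the image of \<open>C\<^sup>T\<close>, which
  contradicts (ii). For (iii), a left null vector of the block matrix is a family of vectors
  \<open>w\<^sub>i\<close> in the summands of (ii) whose sum is annihilated by the transpose of \<open>K\<^sub>C\<close>, that is, lies in
  the image of \<open>C\<^sup>T\<close>; by independence of eigenspaces the family is zero iff its sum is.\<close>

section \<open>Row rank, ranges and sums of vectors\<close>

text \<open>Induction on \<open>S\<close>: a functional found for \<open>S\<close> may fail to kill
  the new vector \<open>b\<close>; it is then corrected by a multiple of a functional
  \<open>u1\<close> that kills \<open>S\<close> but not \<open>b\<close>. The argument is pure
  elimination, because the bilinear product \<open>\<bullet>\<close> need not be definite, for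
  instance on complex vectors.\<close>

lemma (in vec_space) exists_separating_functional:
  assumes "finite S" and "S \<subseteq> carrier_vec n" and "w \<in> carrier_vec n" and "w \<notin> span S"
  shows "\<exists>u\<in>carrier_vec n. (\<forall>s\<in>S. u \<bullet> s = 0) \<and> u \<bullet> w \<noteq> 0"
  using assms
proof (induction S arbitrary: w rule: finite_induct)
  case empty
  then have "w \<noteq> 0\<^sub>v n" using span_empty by auto
  then obtain i where "i < n" "w $ i \<noteq> 0" using empty.prems by (auto simp: vec_eq_iff)
  then show ?case using empty.prems by (intro bexI[of _ "unit_vec n i"]) auto
next
  case (insert b S)
  have b: "b \<in> carrier_vec n" and S: "S \<subseteq> carrier_vec n" and w: "w \<in> carrier_vec n"
    using insert.prems by auto
  have mono: "span S \<subseteq> span (insert b S)" by (rule span_is_monotone) auto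
  obtain u where u: "u \<in> carrier_vec n" "\<forall>s\<in>S. u \<bullet> s = 0" "u \<bullet> w \<noteq> 0"
    using insert.IH[OF S w] insert.prems mono by auto
  show ?case
  proof (cases "\<exists>u1\<in>carrier_vec n. (\<forall>s\<in>S. u1 \<bullet> s = 0) \<and> u1 \<bullet> b \<noteq> 0")
    case False
    with u show ?thesis by (intro bexI[of _ u]) auto
  next
    case True
    then obtain u1 where u1: "u1 \<in> carrier_vec n" "\<forall>s\<in>S. u1 \<bullet> s = 0" "u1 \<bullet> b \<noteq> 0" by auto
    \<comment> \<open>The choice of \<open>c\<close> makes \<open>u1\<close> vanish on
      \<open>w'\<close>. Below, \<open>d\<close> is the multiple for which \<open>u2 - d u1\<close>
      vanishes on \<open>b\<close>; its value at \<open>w\<close> then equals the value of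
      \<open>u2\<close> at \<open>w'\<close>.\<close>
    define c where "c = (u1 \<bullet> w) / (u1 \<bullet> b)"
    define w' where "w' = w - c \<cdot>\<^sub>v b"
    have w': "w' \<in> carrier_vec n" using w b by (simp add: w'_def)
    have "w' \<notin> span S"
    proof
      assume "w' \<in> span S"
      moreover have "b \<in> span (insert b S)" using in_own_span[of "insert b S"] b S by auto
      ultimately have "w' + c \<cdot>\<^sub>v b \<in> span (insert b S)"
        using mono b S w' span_add1[of "insert b S" w' "c \<cdot>\<^sub>v b"] smult_in_span[of "insert b S" b c]
        by auto
      moreover have "w' + c \<cdot>\<^sub>v b = w" using w b by (auto simp: w'_def)
      ultimately show False using insert.prems by auto
    qed
    then obtain u2 where u2: "u2 \<in> carrier_vec n" "\<forall>s\<in>S. u2 \<bullet> s = 0" "u2 \<bullet> w' \<noteq> 0"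
      using insert.IH[OF S w'] by auto
    define d where "d = (u2 \<bullet> b) / (u1 \<bullet> b)"
    have eq: "(u2 - d \<cdot>\<^sub>v u1) \<bullet> x = u2 \<bullet> x - d * (u1 \<bullet> x)" if "x \<in> carrier_vec n" for x
      using that u1 u2 by (simp add: minus_scalar_prod_distrib[of _ n])
    have "u2 \<bullet> w' = u2 \<bullet> w - c * (u2 \<bullet> b)"
      using u2 w b by (simp add: w'_def scalar_prod_minus_distrib[of _ n])
    then have "u2 \<bullet> w - d * (u1 \<bullet> w) \<noteq> 0" using u2 by (simp add: c_def d_def mult.commute)
    moreover have "u2 \<bullet> b - d * (u1 \<bullet> b) = 0" using u1 by (simp add: d_def)
    ultimately show ?thesis using u1 u2 S b w
      by (intro bexI[of _ "u2 - d \<cdot>\<^sub>v u1"]) (auto simp: eq subset_iff)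
  qed
qed

lemma mult_transpose_vec_eq_0_iff:
  assumes "M \<in> carrier_mat nr nc"
  shows "M\<^sup>T *\<^sub>v v = 0\<^sub>v nc \<longleftrightarrow> (\<forall>c\<in>set (cols M). c \<bullet> v = 0)"
  using assms by (auto simp: vec_eq_iff cols_def)

text \<open>If the rank is \<open>nr\<close>, then \<open>nr\<close> independent columns form an
  invertible square matrix, which admits no nonzero left null vector. Conversely, a vector outside
  the column span would be separated from the columns by a nonzero left null vector.\<close>

lemma full_row_rank_iff:
  fixes M :: "'a :: field mat"
  assumes M: "M \<in> carrier_mat nr nc"
  shows "full_row_rank M \<longleftrightarrow> (\<forall>v\<in>carrier_vec nr. M\<^sup>T *\<^sub>v v = 0\<^sub>v nc \<longrightarrow> v = 0\<^sub>v nr)"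
proof -
  interpret vec_space "TYPE('a)" nr .
  have cols: "set (cols M) \<subseteq> carrier_vec nr" using M cols_dim by blast
  have "rank M = nr \<longleftrightarrow> (\<forall>v\<in>carrier_vec nr. (\<forall>c\<in>set (cols M). c \<bullet> v = 0) \<longrightarrow> v = 0\<^sub>v nr)"
  proof
    assume r: "rank M = nr"
    let ?P = "\<lambda>T. T \<subseteq> set (cols M) \<and> lin_indpt T"
    obtain S where S: "maximal S ?P" "finite S"
      using maximal_exists_superset[of "set (cols M)" ?P "{}"]
      by (auto simp: lin_dep_def)
    then have Sc: "S \<subseteq> set (cols M)" "lin_indpt S" by (auto simp: maximal_def)
    have card: "card S = nr" using rank_card_indpt[OF M S(1)] r by simp
    obtain xs where xs: "set xs = S" "distinct xs" using S(2) finite_distinct_list by blast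
    then have len: "length xs = nr" using card distinct_card by fastforce
    define Q where "Q = mat_of_cols nr xs"
    have Q: "Q \<in> carrier_mat nr nr" and cQ: "cols Q = xs"
      using len xs Sc cols by (auto simp: Q_def)
    have "rank Q = nr" using lin_indpt_full_rank[OF Q] cQ xs Sc by auto
    then have "det (Q\<^sup>T) \<noteq> 0" using det_rank_iff[OF Q] det_transpose[OF Q] by auto
    then have inj: "\<forall>v\<in>carrier_vec nr. Q\<^sup>T *\<^sub>v v = 0\<^sub>v nr \<longrightarrow> v = 0\<^sub>v nr"
      using det_0_iff_vec_prod_zero[of "Q\<^sup>T" nr] Q by auto
    show "\<forall>v\<in>carrier_vec nr. (\<forall>c\<in>set (cols M). c \<bullet> v = 0) \<longrightarrow> v = 0\<^sub>v nr"
    proof (intro ballI impI)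
      fix v :: "'a vec" assume v: "v \<in> carrier_vec nr" "\<forall>c\<in>set (cols M). c \<bullet> v = 0"
      then have "Q\<^sup>T *\<^sub>v v = 0\<^sub>v nr"
        using mult_transpose_vec_eq_0_iff[OF Q] cQ xs Sc by auto
      then show "v = 0\<^sub>v nr" using inj v by blast
    qed
  next
    assume *: "\<forall>v\<in>carrier_vec nr. (\<forall>c\<in>set (cols M). c \<bullet> v = 0) \<longrightarrow> v = 0\<^sub>v nr"
    have "carrier_vec nr \<subseteq> span (set (cols M))"
    proof
      fix w :: "'a vec" assume w: "w \<in> carrier_vec nr"
      show "w \<in> span (set (cols M))"
      proof (rule ccontr)
        assume "w \<notin> span (set (cols M))"
        then obtain u where u: "u \<in> carrier_vec nr" "\<forall>s\<in>set (cols M). u \<bullet> s = 0" "u \<bullet> w \<noteq> 0"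
          using exists_separating_functional[OF _ cols w] by auto
        then have "\<forall>s\<in>set (cols M). s \<bullet> u = 0"
          using cols by (auto simp: subset_iff comm_scalar_prod[of _ nr])
        with * u w show False by auto
      qed
    qed
    then have "span (set (cols M)) = carrier V" using span_is_subset2[OF cols[folded module_vec_simps(3)]] by auto
    then have "rank M = dim" by (simp add: rank_def) (simp add: module_vec_def)
    then show "rank M = nr" using dim_is_n by simp
  qed
  then show ?thesis using M mult_transpose_vec_eq_0_iff[OF M] by (auto simp: full_row_rank_def)
qed

text \<open>A vector outside the column space is separated from it by a functional that kills all
  columns, so the range is its own double annihilator. This gives access to the image of
  \<open>C\<^sup>T\<close> through the kernel of \<open>C\<close>.\<close>

lemma mat_range_eq_orthogonal:
  fixes D :: "'a :: field mat"
  assumes D: "D \<in> carrier_mat n p"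
  shows "mat_range D = {w \<in> carrier_vec n. \<forall>u\<in>carrier_vec n. D\<^sup>T *\<^sub>v u = 0\<^sub>v p \<longrightarrow> u \<bullet> w = 0}"
proof -
  interpret vec_space "TYPE('a)" n .
  have cols: "set (cols D) \<subseteq> carrier_vec n" using D cols_dim by blast
  have range: "mat_range D = span (set (cols D))"
    using col_space_eq[OF D] D by (auto simp: mat_range_def col_space_def)
  show ?thesis
  proof (intro equalityI subsetI CollectI conjI ballI impI)
    fix w assume "w \<in> mat_range D"
    then obtain x where x: "x \<in> carrier_vec p" "w = D *\<^sub>v x" using D by (auto simp: mat_range_def)
    then show "w \<in> carrier_vec n" using D by simp
    fix u assume u: "u \<in> carrier_vec n" "D\<^sup>T *\<^sub>v u = 0\<^sub>v p"
    have "u \<bullet> w = (D\<^sup>T *\<^sub>v u) \<bullet> x"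
      using transpose_vec_mult_scalar[OF D x(1) u(1)] x(2) by simp
    then show "u \<bullet> w = 0" using u x by simp
  next
    fix w assume w: "w \<in> {w \<in> carrier_vec n. \<forall>u\<in>carrier_vec n. D\<^sup>T *\<^sub>v u = 0\<^sub>v p \<longrightarrow> u \<bullet> w = 0}"
    show "w \<in> mat_range D"
    proof (rule ccontr)
      assume "w \<notin> mat_range D"
      then obtain u where u: "u \<in> carrier_vec n" "\<forall>s\<in>set (cols D). u \<bullet> s = 0" "u \<bullet> w \<noteq> 0"
        using exists_separating_functional[OF finite_set cols, of w] w range by blast
      then have "\<forall>s\<in>set (cols D). s \<bullet> u = 0"
        using cols by (auto simp: subset_iff comm_scalar_prod[of _ n])
      with u w show False using mult_transpose_vec_eq_0_iff[OF D] by auto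
    qed
  qed
qed

section \<open>Finite sums of vectors, computed entrywise\<close>

lemma finsum_vec_carrier:
  assumes "w \<in> I \<rightarrow> carrier_vec n"
  shows "finsum_vec TYPE('a :: comm_monoid_add) n w I \<in> carrier_vec n"
  using finsum_vec_closed[OF assms] by simp

lemma finsum_vec_eqI:
  fixes v :: "'a :: comm_monoid_add vec"
  assumes "finite I" and "w \<in> I \<rightarrow> carrier_vec n" and "v \<in> carrier_vec n"
    and "\<And>k. k < n \<Longrightarrow> v $ k = (\<Sum>i\<in>I. w i $ k)"
  shows "v = finsum_vec TYPE('a) n w I"
  using assms finsum_vec_carrier[OF assms(2)] by (intro eq_vecI) (auto simp: index_finsum_vec)

lemma mult_mat_finsum_vec:
  fixes M :: "'a :: comm_ring_1 mat"
  assumes M: "M \<in> carrier_mat m n" and I: "finite I" and w: "w \<in> I \<rightarrow> carrier_vec n"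
  shows "M *\<^sub>v finsum_vec TYPE('a) n w I = finsum_vec TYPE('a) m (\<lambda>i. M *\<^sub>v w i) I"
proof (rule finsum_vec_eqI[OF I])
  fix k assume k: "k < m"
  have "(M *\<^sub>v finsum_vec TYPE('a) n w I) $ k
      = (\<Sum>j = 0..<n. \<Sum>i\<in>I. M $$ (k, j) * w i $ j)"
    using M k finsum_vec_carrier[OF w] index_finsum_vec[OF I _ w]
    by (simp add: scalar_prod_def sum_distrib_left)
  also have "\<dots> = (\<Sum>i\<in>I. (M *\<^sub>v w i) $ k)"
  proof (subst sum.swap, rule sum.cong[OF refl])
    fix i assume "i \<in> I"
    then have "w i \<in> carrier_vec n" using w by auto
    then show "(\<Sum>j = 0..<n. M $$ (k, j) * w i $ j) = (M *\<^sub>v w i) $ k"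
      using M k by (auto simp: scalar_prod_def intro!: sum.cong)
  qed
  finally show "(M *\<^sub>v finsum_vec TYPE('a) n w I) $ k = (\<Sum>i\<in>I. (M *\<^sub>v w i) $ k)" .
qed (use M w finsum_vec_carrier[OF w] in \<open>auto intro!: mult_mat_vec_carrier[OF M]\<close>)

section \<open>Products of shifted matrices\<close>

lemma mult_mat_zero_vec:
  "M \<in> carrier_mat nr nc \<Longrightarrow> M *\<^sub>v 0\<^sub>v nc = (0\<^sub>v nr :: 'a :: comm_ring_1 vec)"
  by (intro eq_vecI) auto

lemma smult_zero_vec: "c \<cdot>\<^sub>v 0\<^sub>v n = (0\<^sub>v n :: 'a :: mult_zero vec)"
  by (intro eq_vecI) auto

text \<open>The factors \<open>M - \<mu>\<close> act on a vector and are never multiplied as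
  matrices. The head of the list acts first, so removing it replaces \<open>v\<close> by
  \<open>M v - \<mu> v\<close>, the recursion behind both inductions below.\<close>

definition shifted_prod :: "'a :: comm_ring_1 mat \<Rightarrow> 'a list \<Rightarrow> 'a vec \<Rightarrow> 'a vec" where
  "shifted_prod M = fold (\<lambda>\<mu> v. M *\<^sub>v v - \<mu> \<cdot>\<^sub>v v)"

text \<open>The factor belonging to the last diagonal entry is applied first: it moves the span of the
  first \<open>k + 1\<close> vectors of the triangular basis into the span of the first \<open>k\<close>.\<close>

lemma shifted_prod_upper_triangular_eq_0:
  fixes M :: "'a :: field mat"
  assumes M: "M \<in> carrier_mat n n" and T: "T \<in> carrier_mat n n" "upper_triangular T"
    and P: "P \<in> carrier_mat n n" and Q: "Q \<in> carrier_mat n n"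
    and PQ: "P * Q = 1\<^sub>m n" and QM: "Q * M = T * Q"
    and k: "k \<le> n" and v: "v \<in> carrier_vec n"
    and low: "\<And>i. k \<le> i \<Longrightarrow> i < n \<Longrightarrow> (Q *\<^sub>v v) $ i = 0"
  shows "shifted_prod M (map (\<lambda>i. T $$ (i, i)) (rev [0..<k])) v = 0\<^sub>v n"
  using k v low
proof (induction k arbitrary: v)
  case 0
  then have "Q *\<^sub>v v = 0\<^sub>v n" using Q by (intro eq_vecI) auto
  then have "(P * Q) *\<^sub>v v = 0\<^sub>v n" using P Q 0 by (simp add: mult_mat_zero_vec)
  then show ?case using PQ 0 by (simp add: shifted_prod_def)
next
  case (Suc k)
  let ?t = "T $$ (k, k)"
  let ?v = "M *\<^sub>v v - ?t \<cdot>\<^sub>v v"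
  have v: "v \<in> carrier_vec n" by fact
  have Qv: "Q *\<^sub>v v \<in> carrier_vec n" using Q v by (rule mult_mat_vec_carrier)
  have "Q *\<^sub>v ?v = Q *\<^sub>v (M *\<^sub>v v) - ?t \<cdot>\<^sub>v (Q *\<^sub>v v)"
    using mult_minus_distrib_mat_vec[OF Q, of "M *\<^sub>v v" "?t \<cdot>\<^sub>v v"] mult_mat_vec[OF Q v] M v by simp
  also have "Q *\<^sub>v (M *\<^sub>v v) = T *\<^sub>v (Q *\<^sub>v v)"
    using Q M T v QM by (metis assoc_mult_mat_vec)
  finally have eq: "Q *\<^sub>v ?v = T *\<^sub>v (Q *\<^sub>v v) - ?t \<cdot>\<^sub>v (Q *\<^sub>v v)" .
  have "(Q *\<^sub>v ?v) $ i = 0" if i: "k \<le> i" "i < n" for i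
  proof -
    have "(T *\<^sub>v (Q *\<^sub>v v)) $ i = (\<Sum>j = 0..<n. T $$ (i, j) * (Q *\<^sub>v v) $ j)"
      using T Qv i Q by (simp add: scalar_prod_def)
    \<comment> \<open>Only column \<open>k\<close> contributes: for \<open>j < k\<close> the entry
      lies below the diagonal of \<open>T\<close> because \<open>k \<le> i\<close>, and for
      \<open>j > k\<close> the coordinate of \<open>Q v\<close> vanishes by hypothesis.\<close>
    also have "\<dots> = (\<Sum>j = 0..<n. if j = k then T $$ (i, k) * (Q *\<^sub>v v) $ k else 0)"
    proof (rule sum.cong[OF refl])
      fix j assume j: "j \<in> {0..<n}"
      consider "j < k" | "j = k" | "Suc k \<le> j" by linarith
      then show "T $$ (i, j) * (Q *\<^sub>v v) $ j
          = (if j = k then T $$ (i, k) * (Q *\<^sub>v v) $ k else 0)"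
      proof cases
        case 1
        then have "T $$ (i, j) = 0" using T i by (auto simp: upper_triangular_def)
        then show ?thesis using 1 by simp
      next
        case 3
        then show ?thesis using Suc.prems(3)[of j] j by simp
      qed simp
    qed
    also have "\<dots> = T $$ (i, k) * (Q *\<^sub>v v) $ k" using i by simp
    finally have *: "(T *\<^sub>v (Q *\<^sub>v v)) $ i = T $$ (i, k) * (Q *\<^sub>v v) $ k" .
    \<comment> \<open>For \<open>i = k\<close> the shift by \<open>?t\<close> cancels the one
      remaining term; this is how one more coordinate becomes zero.\<close>
    show ?thesis
    proof (cases "i = k")
      case True
      then show ?thesis using eq * i Qv T Q by simp
    next
      case False
      then have "T $$ (i, k) = 0" and "(Q *\<^sub>v v) $ i = 0"
        using T i Suc.prems(3)[of i] by (auto simp: upper_triangular_def)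
      then show ?thesis using eq * i Qv T Q by simp
    qed
  qed
  then have "shifted_prod M (map (\<lambda>i. T $$ (i, i)) (rev [0..<k])) ?v = 0\<^sub>v n"
    using Suc.prems M v by (intro Suc.IH) auto
  then show ?case by (simp add: shifted_prod_def)
qed

text \<open>A complex matrix is similar to a triangular one, which yields the Cayley-Hamilton
  theorem in factored form. The exact count of \<open>n\<close> factors matters: peeling consumes
  one power of \<open>M\<close> per factor, and the controllability matrix only contains the powers
  below \<open>n\<close>.\<close>

lemma exists_annihilating_shifted_prod:
  fixes M :: "complex mat"
  assumes M: "M \<in> carrier_mat n n"
  obtains \<mu>s where "length \<mu>s = n" and "\<And>v. v \<in> carrier_vec n \<Longrightarrow> shifted_prod M \<mu>s v = 0\<^sub>v n"
proof -
  obtain es where "char_poly M = (\<Prod>a\<leftarrow>es. [:- a, 1:])" using char_poly_factorized[OF M] by auto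
  from schur_decomposition_exists[OF M this] obtain T where T: "T \<in> carrier_mat n n"
    "upper_triangular T" "similar_mat M T" by auto
  from T(3) obtain P Q where "similar_mat_wit M T P Q" by (auto simp: similar_mat_def)
  from similar_mat_witD2[OF M this] have PQ: "P * Q = 1\<^sub>m n" "Q * P = 1\<^sub>m n" "M = P * T * Q"
    "P \<in> carrier_mat n n" "Q \<in> carrier_mat n n" by auto
  have "Q * M = (Q * P) * (T * Q)" unfolding PQ(3) using PQ(4,5) T(1)
    by (simp add: assoc_mult_mat[of _ n n _ n _ n])
  then have QM: "Q * M = T * Q" using PQ T by simp
  show ?thesis
    \<comment> \<open>With \<open>k = n\<close> the condition on vanishing coordinates is
      empty.\<close>
    by (rule that[of "map (\<lambda>i. T $$ (i, i)) (rev [0..<n])"])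
      (use shifted_prod_upper_triangular_eq_0[OF M T(1,2) PQ(4,5,1) QM order_refl] in auto)
qed

text \<open>Peel off one factor: given \<open>(M - \<mu>) v = \<Sum>\<^sub>i w\<^sub>i\<close>, subtract from \<open>v\<close> the sum of
  \<open>w\<^sub>i / (\<lambda>\<^sub>i - \<mu>)\<close> over \<open>\<lambda>\<^sub>i \<noteq> \<mu>\<close>. The remainder \<open>y\<close> satisfies \<open>(M - \<mu>) y = w\<^sub>j\<close> with \<open>\<lambda>\<^sub>j = \<mu>\<close>
  (or \<open>0\<close>), so it is an eigenvector or the top of a chain over \<open>w\<^sub>j\<close>. Since only \<open>n\<close> factors
  are needed, the bound \<open>k < n\<close> on the powers suffices and \<open>W\<close> need not be shown invariant.\<close>

lemma shifted_prod_eq_0_cases: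
  fixes M D :: "'a :: field mat"
  assumes M: "M \<in> carrier_mat n n" and D: "D \<in> carrier_mat m n" and ls: "distinct ls"
    and ev: "\<And>l. eigenvalue M l \<Longrightarrow> l \<in> set ls"
    and E: "\<And>i x. i < length ls \<Longrightarrow>
      x \<in> E i \<longleftrightarrow> x \<in> carrier_vec n \<and> M *\<^sub>v x = ls ! i \<cdot>\<^sub>v x \<and> D *\<^sub>v x = 0\<^sub>v m"
    and v: "v \<in> carrier_vec n" and "shifted_prod M \<mu>s v = 0\<^sub>v n"
    and "\<And>k. k < length \<mu>s \<Longrightarrow> D *\<^sub>v ((M ^\<^sub>m k) *\<^sub>v v) = 0\<^sub>v m"
  shows "v \<in> subspace_sum n {..<length ls} E \<or>
    (\<exists>i<length ls. \<exists>x0 x1. x0 \<in> E i \<and> x0 \<noteq> 0\<^sub>v n \<and> x1 \<in> carrier_vec n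
       \<and> M *\<^sub>v x1 - ls ! i \<cdot>\<^sub>v x1 = x0)"
    (is "?S v \<or> ?chain")
  using v assms(7,8)
proof (induction \<mu>s arbitrary: v)
  case Nil
  have "(\<lambda>i. 0\<^sub>v n) \<in> Pi {..<length ls} E"
    using M D E by (auto simp: mult_mat_zero_vec smult_zero_vec)
  moreover have "v = finsum_vec TYPE('a) n (\<lambda>i. 0\<^sub>v n) {..<length ls}"
    using Nil by (intro finsum_vec_eqI) (auto simp: shifted_prod_def)
  ultimately show ?case unfolding subspace_sum_def by blast
next
  case (Cons \<mu> \<mu>s)
  let ?I = "{..<length ls}"
  let ?v = "M *\<^sub>v v - \<mu> \<cdot>\<^sub>v v"
  have v: "v \<in> carrier_vec n" by fact
  have pow: "M ^\<^sub>m k \<in> carrier_mat n n" for k using M by simp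
  \<comment> \<open>Applying \<open>M - \<mu>\<close> uses up one power: the condition at
    \<open>k\<close> for \<open>?v\<close> combines those at \<open>k + 1\<close> and
    \<open>k\<close> for \<open>v\<close>, so the bound shrinks together with the list.\<close>
  have "D *\<^sub>v ((M ^\<^sub>m k) *\<^sub>v ?v) = 0\<^sub>v m" if "k < length \<mu>s" for k
  proof -
    have "(M ^\<^sub>m k) *\<^sub>v (M *\<^sub>v v) = (M ^\<^sub>m Suc k) *\<^sub>v v"
      using assoc_mult_mat_vec[OF pow[of k] M v] by simp
    then have "(M ^\<^sub>m k) *\<^sub>v ?v = (M ^\<^sub>m Suc k) *\<^sub>v v - \<mu> \<cdot>\<^sub>v ((M ^\<^sub>m k) *\<^sub>v v)"
      using mult_minus_distrib_mat_vec[OF pow[of k], of "M *\<^sub>v v" "\<mu> \<cdot>\<^sub>v v"]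
        mult_mat_vec[OF pow[of k] v] M v by (simp del: pow_mat.simps)
    then have "D *\<^sub>v ((M ^\<^sub>m k) *\<^sub>v ?v)
      = D *\<^sub>v ((M ^\<^sub>m Suc k) *\<^sub>v v) - \<mu> \<cdot>\<^sub>v (D *\<^sub>v ((M ^\<^sub>m k) *\<^sub>v v))"
      using mult_minus_distrib_mat_vec[OF D, of "(M ^\<^sub>m Suc k) *\<^sub>v v" "\<mu> \<cdot>\<^sub>v ((M ^\<^sub>m k) *\<^sub>v v)"]
        mult_mat_vec[OF D, of "(M ^\<^sub>m k) *\<^sub>v v"]
        mult_mat_vec_carrier[OF pow[of k] v] mult_mat_vec_carrier[OF pow[of "Suc k"] v]
      by (simp del: pow_mat.simps)
    then show ?thesis using Cons.prems(3)[of k] Cons.prems(3)[of "Suc k"] that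
      by (simp add: smult_zero_vec del: pow_mat.simps)
  qed
  then have "?S ?v \<or> ?chain"
    using Cons.prems M v by (intro Cons.IH) (auto simp: shifted_prod_def)
  moreover have "?S v \<or> ?chain" if S: "?S ?v"
  proof -
    obtain w where w: "w \<in> Pi ?I E" and vw: "?v = finsum_vec TYPE('a) n w ?I"
      using S by (auto simp: subspace_sum_def)
    have wE: "w i \<in> carrier_vec n" "M *\<^sub>v w i = ls ! i \<cdot>\<^sub>v w i" "D *\<^sub>v w i = 0\<^sub>v m"
      if "i < length ls" for i using w that E[OF that, of "w i"] by auto
    \<comment> \<open>At the resonant index, where \<open>ls ! i = \<mu>\<close>, the coefficient is
      set to \<open>0\<close>. This leaves the slot empty for the remainder
      \<open>y\<close>.\<close>
    define u where "u i = (if ls ! i = \<mu> then 0 else 1 / (ls ! i - \<mu>)) \<cdot>\<^sub>v w i" for i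
    have uE: "u i \<in> carrier_vec n" "M *\<^sub>v u i = ls ! i \<cdot>\<^sub>v u i" "D *\<^sub>v u i = 0\<^sub>v m"
      if "i < length ls" for i
      using wE[OF that] M D
      by (simp_all add: u_def mult_mat_vec[of _ n n] mult_mat_vec[of _ m n] smult_smult_assoc mult.commute smult_zero_vec)
    define f where "f = finsum_vec TYPE('a) n u ?I"
    have fc: "f \<in> carrier_vec n" unfolding f_def using uE by (intro finsum_vec_carrier) auto
    have findex: "f $ k = (\<Sum>i<length ls. u i $ k)" if "k < n" for k
      unfolding f_def using uE that by (intro index_finsum_vec) auto
    have Mf: "(M *\<^sub>v f) $ k = (\<Sum>i<length ls. ls ! i * u i $ k)" if "k < n" for k
    proof -
      have "M *\<^sub>v f = finsum_vec TYPE('a) n (\<lambda>i. M *\<^sub>v u i) ?I"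
        unfolding f_def using uE by (intro mult_mat_finsum_vec[OF M]) auto
      then have "(M *\<^sub>v f) $ k = (\<Sum>i<length ls. (M *\<^sub>v u i) $ k)"
        using index_finsum_vec[of ?I k n "\<lambda>i. M *\<^sub>v u i"] that uE M
        by (auto intro!: mult_mat_vec_carrier)
      also have "\<dots> = (\<Sum>i<length ls. ls ! i * u i $ k)"
      proof (rule sum.cong[OF refl])
        fix i assume "i \<in> ?I"
        then have "u i \<in> carrier_vec n" "M *\<^sub>v u i = ls ! i \<cdot>\<^sub>v u i" using uE by auto
        then show "(M *\<^sub>v u i) $ k = ls ! i * u i $ k" using that by simp
      qed
      finally show ?thesis .
    qed
    have Df: "D *\<^sub>v f = 0\<^sub>v m"
    proof -
      have "D *\<^sub>v f = finsum_vec TYPE('a) m (\<lambda>i. D *\<^sub>v u i) ?I"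
        unfolding f_def using uE by (intro mult_mat_finsum_vec[OF D]) auto
      also have "\<dots> = 0\<^sub>v m"
        by (rule sym, rule finsum_vec_eqI) (use uE in auto)
      finally show ?thesis .
    qed
    define y where "y = v - f"
    have yc: "y \<in> carrier_vec n" using v fc by (simp add: y_def)
    \<comment> \<open>The instance \<open>k = 0\<close>, available because the list of factors is
      nonempty.\<close>
    have "D *\<^sub>v v = 0\<^sub>v m" using Cons.prems(3)[of 0] M v by simp
    then have Dy: "D *\<^sub>v y = 0\<^sub>v m"
      using D v fc Df by (simp add: y_def mult_minus_distrib_mat_vec[of _ m n])
    have My: "M *\<^sub>v y - \<mu> \<cdot>\<^sub>v y = ?v - (M *\<^sub>v f - \<mu> \<cdot>\<^sub>v f)"
      using M v fc
      by (intro eq_vecI) (auto simp: y_def mult_minus_distrib_mat_vec[of _ n n] algebra_simps)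
    \<comment> \<open>Off resonance \<open>M - \<mu>\<close> scales \<open>u i\<close> back to
      \<open>w i\<close>, so these terms cancel.\<close>
    have resid: "(M *\<^sub>v y - \<mu> \<cdot>\<^sub>v y) $ k = (\<Sum>i<length ls. if ls ! i = \<mu> then w i $ k else 0)"
      if k: "k < n" for k
    proof -
      have "(M *\<^sub>v y - \<mu> \<cdot>\<^sub>v y) $ k = ?v $ k - ((M *\<^sub>v f) $ k - \<mu> * f $ k)"
        unfolding My using k M fc v by simp
      also have "?v $ k = (\<Sum>i<length ls. w i $ k)"
        unfolding vw using wE k by (intro index_finsum_vec) auto
      also have "(\<Sum>i<length ls. w i $ k) - ((M *\<^sub>v f) $ k - \<mu> * f $ k)
          = (\<Sum>i<length ls. w i $ k - (ls ! i - \<mu>) * u i $ k)"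
        using k by (simp add: Mf findex sum_subtractf sum_distrib_left algebra_simps)
      also have "\<dots> = (\<Sum>i<length ls. if ls ! i = \<mu> then w i $ k else 0)"
      proof (rule sum.cong[OF refl])
        fix i assume "i \<in> ?I"
        then have "w i \<in> carrier_vec n" using wE by auto
        then show "w i $ k - (ls ! i - \<mu>) * u i $ k = (if ls ! i = \<mu> then w i $ k else 0)"
          using k by (simp add: u_def)
      qed
      finally show ?thesis .
    qed
    show ?thesis
    proof (cases "\<mu> \<in> set ls")
      \<comment> \<open>Since \<open>ls\<close> contains all eigenvalues, \<open>\<mu>\<close> is
        not one, and the remainder \<open>y\<close>, which satisfies the eigenvector equation, must
        vanish.\<close>
      case False
      then have "M *\<^sub>v y - \<mu> \<cdot>\<^sub>v y = 0\<^sub>v n"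
        using resid yc M by (intro eq_vecI) (auto intro!: sum.neutral)
      then have "M *\<^sub>v y = \<mu> \<cdot>\<^sub>v y" using yc M by (auto simp: vec_eq_iff)
      then have "y = 0\<^sub>v n" using False ev[of \<mu>] yc M by (auto simp: eigenvalue_def eigenvector_def)
      then have "v = f" using v fc by (auto simp: y_def vec_eq_iff)
      moreover have "u \<in> Pi ?I E" using uE E by auto
      ultimately show ?thesis unfolding subspace_sum_def f_def by blast
    next
      case True
      then obtain j where j: "j < length ls" "ls ! j = \<mu>" by (auto simp: in_set_conv_nth)
      then have iff: "ls ! i = \<mu> \<longleftrightarrow> i = j" if "i < length ls" for i
        using ls that by (auto simp: nth_eq_iff_index_eq)
      have "(\<Sum>i<length ls. if ls ! i = \<mu> then w i $ k else 0) = w j $ k" for k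
      proof -
        have "(\<Sum>i<length ls. if ls ! i = \<mu> then w i $ k else 0)
            = (\<Sum>i<length ls. if i = j then w j $ k else 0)"
          using iff by (intro sum.cong) auto
        then show ?thesis using j by simp
      qed
      then have yw: "M *\<^sub>v y - \<mu> \<cdot>\<^sub>v y = w j"
        using resid yc M wE[OF j(1)] by (intro eq_vecI) auto
      \<comment> \<open>If \<open>w j\<close> is nonzero, \<open>y\<close> is the second vector of a
        chain above it; otherwise \<open>y\<close> itself belongs to \<open>E j\<close> and fills
        the empty slot.\<close>
      show ?thesis
      proof (cases "w j = 0\<^sub>v n")
        case False
        have "w j \<in> E j" using w j by auto
        with False yw yc j show ?thesis by blast
      next
        case True
        then have My0: "M *\<^sub>v y = \<mu> \<cdot>\<^sub>v y" using yw yc M by (auto simp: vec_eq_iff)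
        have "u(j := y) \<in> Pi ?I E" using uE E yc My0 Dy j by auto
        moreover have "v = finsum_vec TYPE('a) n (u(j := y)) ?I"
        proof (rule finsum_vec_eqI)
          fix k assume k: "k < n"
          have "(\<Sum>i<length ls. (u(j := y)) i $ k) = (\<Sum>i<length ls. u i $ k + (if i = j then y $ k else 0))"
            using True j k by (intro sum.cong) (auto simp: u_def)
          also have "\<dots> = f $ k + y $ k" using j k by (simp add: sum.distrib findex)
          also have "\<dots> = v $ k" using v fc k by (simp add: y_def)
          finally show "v $ k = (\<Sum>i<length ls. (u(j := y)) i $ k)" by simp
        qed (use uE yc v in auto)
        ultimately show ?thesis unfolding subspace_sum_def by blast
      qed
    qed
  qed
  ultimately show ?case by blast
qed

section \<open>Real and complex matrices\<close>

lemma Re_cmat_mult_vec: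
  "X \<in> carrier_mat nr nc \<Longrightarrow> v \<in> carrier_vec nc \<Longrightarrow>
    map_vec Re (cmat X *\<^sub>v v) = X *\<^sub>v map_vec Re v"
  by (intro eq_vecI) (auto simp: scalar_prod_def)

lemma Im_cmat_mult_vec:
  "X \<in> carrier_mat nr nc \<Longrightarrow> v \<in> carrier_vec nc \<Longrightarrow>
    map_vec Im (cmat X *\<^sub>v v) = X *\<^sub>v map_vec Im v"
  by (intro eq_vecI) (auto simp: scalar_prod_def)

lemma complex_vec_eqI:
  assumes "map_vec Re v = map_vec Re w" and "map_vec Im v = map_vec Im w"
  shows "v = w"
proof (rule eq_vecI)
  show dim: "dim_vec v = dim_vec w" using assms(1) by (metis index_map_vec(2))
  fix i assume "i < dim_vec w"
  then show "v $ i = w $ i" using assms dim by (metis complex_eqI index_map_vec(1))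
qed

text \<open>A real matrix acts separately on real and imaginary parts. This is the bridge between
  real rank conditions and complex subspaces.\<close>

lemma cmat_mult_vec_eq_0_iff:
  assumes "X \<in> carrier_mat nr nc" and "v \<in> carrier_vec nc"
  shows "cmat X *\<^sub>v v = 0\<^sub>v nr \<longleftrightarrow>
    X *\<^sub>v map_vec Re v = 0\<^sub>v nr \<and> X *\<^sub>v map_vec Im v = 0\<^sub>v nr"
proof -
  have "cmat X *\<^sub>v v = 0\<^sub>v nr \<longleftrightarrow>
      map_vec Re (cmat X *\<^sub>v v) = 0\<^sub>v nr \<and> map_vec Im (cmat X *\<^sub>v v) = 0\<^sub>v nr"
    by (auto intro!: complex_vec_eqI)
  then show ?thesis using Re_cmat_mult_vec[OF assms] Im_cmat_mult_vec[OF assms] by simp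
qed

text \<open>The relation between \<open>K\<close> and \<open>C\<close> is given over the reals,
  whereas eigenvectors are complex. It carries over because real and imaginary parts can be treated
  separately and reassembled.\<close>

lemma mat_kernel_cmat_eq_mat_range:
  assumes C: "C \<in> carrier_mat p n" and K: "K \<in> carrier_mat n q"
    and CK: "mat_range K = mat_kernel C"
  shows "mat_kernel (cmat C) = mat_range (cmat K)"
proof (intro equalityI subsetI)
  fix u assume "u \<in> mat_kernel (cmat C)"
  then have u: "u \<in> carrier_vec n" "cmat C *\<^sub>v u = 0\<^sub>v p" using C by (auto simp: mat_kernel_def)
  then have "map_vec Re u \<in> mat_range K" "map_vec Im u \<in> mat_range K"
    using C unfolding CK cmat_mult_vec_eq_0_iff[OF C u(1)] by (auto simp: mat_kernel_def)
  then obtain x y where xy: "x \<in> carrier_vec q" "map_vec Re u = K *\<^sub>v x"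
    "y \<in> carrier_vec q" "map_vec Im u = K *\<^sub>v y" using K by (auto simp: mat_range_def)
  define z where "z = vec q (\<lambda>i. Complex (x $ i) (y $ i))"
  have z: "z \<in> carrier_vec q" "map_vec Re z = x" "map_vec Im z = y"
    using xy by (auto simp: z_def)
  have "u = cmat K *\<^sub>v z"
    using xy z by (intro complex_vec_eqI) (simp_all add: Re_cmat_mult_vec[OF K] Im_cmat_mult_vec[OF K])
  then show "u \<in> mat_range (cmat K)" using z K by (auto simp: mat_range_def)
next
  fix u assume "u \<in> mat_range (cmat K)"
  then obtain z where z: "z \<in> carrier_vec q" "u = cmat K *\<^sub>v z" using K by (auto simp: mat_range_def)
  have u: "u \<in> carrier_vec n" using z K by simp
  have *: "C *\<^sub>v (K *\<^sub>v x) = 0\<^sub>v p" if "x \<in> carrier_vec q" for x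
  proof -
    have "K *\<^sub>v x \<in> mat_range K" using that K by (auto simp: mat_range_def)
    then show ?thesis using C unfolding CK by (auto simp: mat_kernel_def)
  qed
  have "cmat C *\<^sub>v u = 0\<^sub>v p"
    unfolding cmat_mult_vec_eq_0_iff[OF C u]
    using z Re_cmat_mult_vec[OF K z(1)] Im_cmat_mult_vec[OF K z(1)] by (simp add: *)
  then show "u \<in> mat_kernel (cmat C)" using u C by (auto simp: mat_kernel_def)
qed

text \<open>The image of \<open>C\<^sup>T\<close> is the annihilator of the kernel of
  \<open>C\<close>, hence of the range of \<open>K\<close>, and annihilating that range means being
  killed by \<open>K\<^sup>T\<close>. This turns the image in (ii) into the condition produced by
  the Kronecker block in (iii).\<close>

lemma mat_range_transpose_eq_kernel_transpose:
  fixes C K :: "'a :: field mat"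
  assumes C: "C \<in> carrier_mat p n" and K: "K \<in> carrier_mat n q"
    and CK: "mat_kernel C = mat_range K"
  shows "mat_range (C\<^sup>T) = {w \<in> carrier_vec n. K\<^sup>T *\<^sub>v w = 0\<^sub>v q}"
proof -
  have "(\<forall>u\<in>carrier_vec n. C *\<^sub>v u = 0\<^sub>v p \<longrightarrow> u \<bullet> w = 0) \<longleftrightarrow> K\<^sup>T *\<^sub>v w = 0\<^sub>v q"
    if w: "w \<in> carrier_vec n" for w
  proof -
    have "(\<forall>u\<in>carrier_vec n. C *\<^sub>v u = 0\<^sub>v p \<longrightarrow> u \<bullet> w = 0) \<longleftrightarrow> (\<forall>u\<in>mat_kernel C. u \<bullet> w = 0)"
      using C by (auto simp: mat_kernel_def)
    also have "\<dots> \<longleftrightarrow> (\<forall>x\<in>carrier_vec q. (K *\<^sub>v x) \<bullet> w = 0)"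
      using K unfolding CK by (auto simp: mat_range_def)
    also have "\<dots> \<longleftrightarrow> (\<forall>x\<in>carrier_vec q. (K\<^sup>T *\<^sub>v w) \<bullet> x = 0)"
      using transpose_vec_mult_scalar[OF K _ w] w K
      by (metis comm_scalar_prod mult_mat_vec_carrier)
    also have "\<dots> \<longleftrightarrow> K\<^sup>T *\<^sub>v w = 0\<^sub>v q"
    proof
      assume *: "\<forall>x\<in>carrier_vec q. (K\<^sup>T *\<^sub>v w) \<bullet> x = 0"
      show "K\<^sup>T *\<^sub>v w = 0\<^sub>v q"
      proof (rule eq_vecI)
        fix j assume "j < dim_vec (0\<^sub>v q :: 'a vec)"
        then show "(K\<^sup>T *\<^sub>v w) $ j = 0\<^sub>v q $ j"
          using *[rule_format, of "unit_vec q j"] K w by simp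
      qed (use K in auto)
    qed simp
    finally show ?thesis .
  qed
  then show ?thesis using mat_range_eq_orthogonal[of "C\<^sup>T" n p] C by auto
qed

lemma pow_mat_mult_left:
  fixes A :: "'a :: semiring_1 mat"
  assumes "A \<in> carrier_mat n n"
  shows "A * A ^\<^sub>m k = A ^\<^sub>m k * A"
proof (induction k)
  case (Suc k)
  then show ?case using assms by (simp add: assoc_mult_mat[of _ n n _ n _ n, symmetric])
qed (use assms in simp)

lemma transpose_pow_mat:
  fixes A :: "'a :: comm_semiring_1 mat"
  assumes "A \<in> carrier_mat n n"
  shows "(A ^\<^sub>m k)\<^sup>T = A\<^sup>T ^\<^sub>m k"
proof (induction k)
  case (Suc k)
  then show ?case using assms
    by (simp add: transpose_mult[of _ n n _ n] pow_mat_mult_left[of "A\<^sup>T" n])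
qed (use assms in simp)

section \<open>Kernels of transposed block matrices\<close>

lemma block_row_carrier:
  "block_row nr Ms \<in> carrier_mat nr (sum_list (map dim_col Ms))"
  by (rule carrier_matI) (simp_all add: block_row_def length_concat comp_def)

lemma transpose_block_row_mult_eq_0_iff:
  assumes "\<And>X. X \<in> set Ms \<Longrightarrow> dim_row X = nr"
  shows "(block_row nr Ms)\<^sup>T *\<^sub>v v = 0\<^sub>v (dim_col (block_row nr Ms)) \<longleftrightarrow>
    (\<forall>X\<in>set Ms. X\<^sup>T *\<^sub>v v = 0\<^sub>v (dim_col X))"
proof -
  have "set (concat (map cols Ms)) \<subseteq> carrier_vec nr"
    using assms by (auto simp: cols_def col_def)
  then have "cols (block_row nr Ms) = concat (map cols Ms)" by (simp add: block_row_def)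
  moreover have "X\<^sup>T *\<^sub>v v = 0\<^sub>v (dim_col X) \<longleftrightarrow> (\<forall>c\<in>set (cols X). c \<bullet> v = 0)" for X :: "'a mat"
    by (rule mult_transpose_vec_eq_0_iff[of _ "dim_row X"]) simp
  ultimately show ?thesis by simp
qed

text \<open>A left null vector of the matrix in (i) satisfies one equation per block. The matrix is
  real, but \<open>z\<close> is complex so that the condition can be compared with complex
  eigenspaces.\<close>

lemma output_controllable_iff:
  assumes A: "A \<in> carrier_mat n n" and B: "B \<in> carrier_mat n m" and C: "C \<in> carrier_mat p n"
  shows "output_controllable A B C \<longleftrightarrow>
    (\<forall>z\<in>carrier_vec p. (\<forall>k<n. (cmat B)\<^sup>T *\<^sub>v (((cmat A)\<^sup>T ^\<^sub>m k) *\<^sub>v ((cmat C)\<^sup>T *\<^sub>v z)) = 0\<^sub>v m)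
       \<longrightarrow> z = 0\<^sub>v p)"
proof -
  \<comment> \<open>\<open>Y k\<close> is the transpose of the block
    \<open>C * A ^\<^sub>m k * B\<close>.\<close>
  define Y where "Y k = B\<^sup>T * ((A\<^sup>T ^\<^sub>m k) * C\<^sup>T)" for k
  have pow: "A ^\<^sub>m k \<in> carrier_mat n n" "A\<^sup>T ^\<^sub>m k \<in> carrier_mat n n" for k using A by auto
  have Y: "Y k \<in> carrier_mat m p" for k
    unfolding Y_def using B C pow[of k] by (intro mult_carrier_mat[of _ _ n]) auto
  let ?N = "controllability_mat A B"
  let ?Ms = "map (\<lambda>k. (A ^\<^sub>m k) * B) [0..<n]"
  have ctrb: "?N = block_row n ?Ms" using A by (simp add: controllability_mat_def)
  define q where "q = dim_col (block_row n ?Ms)"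
  have q: "dim_col (block_row n ?Ms) = q" by (simp only: q_def)
  have N: "?N \<in> carrier_mat n q"
    using block_row_carrier[of n ?Ms] q unfolding ctrb by (metis carrier_matD(2))
  have CN: "C * ?N \<in> carrier_mat p q" using C N by simp
  have "(C * ?N)\<^sup>T *\<^sub>v z = 0\<^sub>v q \<longleftrightarrow> (\<forall>k<n. Y k *\<^sub>v z = 0\<^sub>v m)" if z: "z \<in> carrier_vec p" for z
  proof -
    have "(C * ?N)\<^sup>T *\<^sub>v z = ?N\<^sup>T *\<^sub>v (C\<^sup>T *\<^sub>v z)"
      using C N z by (simp add: transpose_mult[of _ p n _ q] assoc_mult_mat_vec[of _ q n _ p])
    moreover have "?N\<^sup>T *\<^sub>v (C\<^sup>T *\<^sub>v z) = 0\<^sub>v q \<longleftrightarrow>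
        (\<forall>X\<in>set ?Ms. X\<^sup>T *\<^sub>v (C\<^sup>T *\<^sub>v z) = 0\<^sub>v (dim_col X))"
      unfolding ctrb by (rule transpose_block_row_mult_eq_0_iff[of ?Ms n, unfolded q])
        (use A in auto)
    moreover have "(A ^\<^sub>m k * B)\<^sup>T *\<^sub>v (C\<^sup>T *\<^sub>v z) = Y k *\<^sub>v z" for k
    proof -
      have "(A ^\<^sub>m k * B)\<^sup>T = B\<^sup>T * (A\<^sup>T ^\<^sub>m k)"
        using transpose_mult[OF pow(1)[of k] B] by (simp add: transpose_pow_mat[OF A])
      moreover have "(B\<^sup>T * (A\<^sup>T ^\<^sub>m k)) * C\<^sup>T = Y k"
        unfolding Y_def using B C pow[of k] by (intro assoc_mult_mat[of _ m n _ n _ p]) auto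
      moreover have "B\<^sup>T * (A\<^sup>T ^\<^sub>m k) \<in> carrier_mat m n"
        using B pow(2)[of k] by (intro mult_carrier_mat[of _ _ n]) auto
      ultimately show ?thesis
        using assoc_mult_mat_vec[of "B\<^sup>T * (A\<^sup>T ^\<^sub>m k)" m n "C\<^sup>T" p z] C z by simp
    qed
    ultimately show ?thesis using B by (auto simp: set_map)
  qed
  then have "output_controllable A B C \<longleftrightarrow>
      (\<forall>z\<in>carrier_vec p. (\<forall>k<n. Y k *\<^sub>v z = 0\<^sub>v m) \<longrightarrow> z = 0\<^sub>v p)"
    using full_row_rank_iff[OF CN] by (auto simp: output_controllable_def)
  \<comment> \<open>Real and imaginary parts of a complex solution are real solutions; conversely a
    real solution is also a complex one.\<close>
  also have "\<dots> \<longleftrightarrow>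
      (\<forall>z\<in>carrier_vec p. (\<forall>k<n. cmat (Y k) *\<^sub>v z = 0\<^sub>v m) \<longrightarrow> z = 0\<^sub>v p)" (is "?r \<longleftrightarrow> ?c")
  proof
    assume r: ?r
    show ?c
    proof (intro ballI impI)
      fix z :: "complex vec" assume z: "z \<in> carrier_vec p" and 0: "\<forall>k<n. cmat (Y k) *\<^sub>v z = 0\<^sub>v m"
      have "map_vec Re z = 0\<^sub>v p" "map_vec Im z = 0\<^sub>v p"
        using r 0 z cmat_mult_vec_eq_0_iff[OF Y z] by auto
      then show "z = 0\<^sub>v p" by (intro complex_vec_eqI) (auto simp: vec_eq_iff)
    qed
  next
    assume c: ?c
    show ?r
    proof (intro ballI impI)
      fix x :: "real vec" assume x: "x \<in> carrier_vec p" and 0: "\<forall>k<n. Y k *\<^sub>v x = 0\<^sub>v m"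
      let ?z = "map_vec complex_of_real x"
      have z: "?z \<in> carrier_vec p" using x by simp
      have "map_vec Re ?z = x" "map_vec Im ?z = 0\<^sub>v p" using x by auto
      then have "\<forall>k<n. cmat (Y k) *\<^sub>v ?z = 0\<^sub>v m"
        using 0 cmat_mult_vec_eq_0_iff[OF Y z] Y by (auto simp: mult_mat_zero_vec[OF Y])
      then have "?z = 0\<^sub>v p" using c z by blast
      then show "x = 0\<^sub>v p" using x by (auto simp: vec_eq_iff)
    qed
  qed
  also have "\<dots> \<longleftrightarrow> (\<forall>z\<in>carrier_vec p.
      (\<forall>k<n. (cmat B)\<^sup>T *\<^sub>v (((cmat A)\<^sup>T ^\<^sub>m k) *\<^sub>v ((cmat C)\<^sup>T *\<^sub>v z)) = 0\<^sub>v m) \<longrightarrow> z = 0\<^sub>v p)"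
  proof -
    have "cmat (Y k) *\<^sub>v z = (cmat B)\<^sup>T *\<^sub>v (((cmat A)\<^sup>T ^\<^sub>m k) *\<^sub>v ((cmat C)\<^sup>T *\<^sub>v z))"
      if z: "z \<in> carrier_vec p" for z k
    proof -
      have cpow: "(cmat A)\<^sup>T ^\<^sub>m k \<in> carrier_mat n n" using A by auto
      have "cmat (Y k) = cmat (B\<^sup>T) * (cmat (A\<^sup>T ^\<^sub>m k) * cmat (C\<^sup>T))"
        using B C pow[of k] unfolding Y_def
        by (simp add: of_real_hom.mat_hom_mult[of _ m n _ p] of_real_hom.mat_hom_mult[of _ n n _ p])
      then have "cmat (Y k) = (cmat B)\<^sup>T * (((cmat A)\<^sup>T ^\<^sub>m k) * (cmat C)\<^sup>T)"
        using A by (simp add: of_real_hom.mat_hom_pow[of "A\<^sup>T" n] map_mat_transpose)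
      then show ?thesis using cpow B C z
        by (simp add: assoc_mult_mat_vec[of _ m n _ p] assoc_mult_mat_vec[of _ n n _ p])
    qed
    then show ?thesis by simp
  qed
  finally show ?thesis .
qed

section \<open>Stacked vectors, diagonal blocks and the Kronecker product with the all-ones
  column\<close>

definition vec_block :: "nat \<Rightarrow> 'a vec \<Rightarrow> nat \<Rightarrow> 'a vec" where
  "vec_block n v i = vec n (\<lambda>a. v $ (i * n + a))"

lemma vec_block_carrier[simp]: "vec_block n v i \<in> carrier_vec n"
  by (simp add: vec_block_def)

lemma four_block_diag_mult_vec:
  fixes F G :: "'a :: comm_ring_1 mat"
  assumes F: "F \<in> carrier_mat c1 n1" and G: "G \<in> carrier_mat c2 n2"
    and a: "a \<in> carrier_vec n1" and b: "b \<in> carrier_vec n2"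
  shows "four_block_mat F (0\<^sub>m c1 n2) (0\<^sub>m c2 n1) G *\<^sub>v (a @\<^sub>v b) = (F *\<^sub>v a) @\<^sub>v (G *\<^sub>v b)"
proof -
  have "(0\<^sub>m c1 n2 :: 'a mat) *\<^sub>v b = 0\<^sub>v c1" and "(0\<^sub>m c2 n1 :: 'a mat) *\<^sub>v a = 0\<^sub>v c2"
    using a b by (auto simp: vec_eq_iff)
  then show ?thesis
    using four_block_mat_mult_vec[OF F zero_carrier_mat zero_carrier_mat G a b] F G a b by simp
qed

text \<open>The blocks may differ in width, but all have \<open>n\<close> rows, so after
  transposition \<open>v\<close> is cut into equal pieces. The induction follows the recursion of
  \<open>diag_block_mat\<close>, which splits off the first block as a corner of a four-block
  matrix.\<close>

lemma transpose_diag_block_mat_mult_eq_0_iff: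
  fixes Ms :: "'a :: comm_ring_1 mat list"
  assumes "\<And>X. X \<in> set Ms \<Longrightarrow> dim_row X = n" and "v \<in> carrier_vec (length Ms * n)"
  shows "(diag_block_mat Ms)\<^sup>T *\<^sub>v v = 0\<^sub>v (dim_col (diag_block_mat Ms)) \<longleftrightarrow>
    (\<forall>i<length Ms. (Ms ! i)\<^sup>T *\<^sub>v vec_block n v i = 0\<^sub>v (dim_col (Ms ! i)))"
  using assms
proof (induction Ms arbitrary: v)
  case Nil
  then show ?case by auto
next
  case (Cons X Ms)
  let ?B = "diag_block_mat Ms"
  let ?N = "length Ms * n"
  have X: "X \<in> carrier_mat n (dim_col X)" using Cons.prems(1)[of X] by auto
  have rowB: "dim_row ?B = ?N"
    using Cons.prems(1) by (simp add: dim_diag_block_mat sum_list_triv cong: map_cong)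
  have B: "?B \<in> carrier_mat ?N (dim_col ?B)" using rowB by auto
  have v: "v \<in> carrier_vec (n + ?N)" using Cons.prems(2) by simp
  define a where "a = vec_block n v 0"
  define b where "b = vec ?N (\<lambda>j. v $ (n + j))"
  have ab: "a \<in> carrier_vec n" "b \<in> carrier_vec ?N" by (auto simp: a_def b_def)
  have vab: "v = a @\<^sub>v b" using v by (intro eq_vecI) (auto simp: a_def b_def vec_block_def)
  \<comment> \<open>Removing the first \<open>n\<close> entries shifts the block index by one; the
    bound inside keeps the indices within the tail \<open>b\<close>.\<close>
  have block: "vec_block n b i = vec_block n v (Suc i)" if "i < length Ms" for i
  proof -
    have "i * n + j < ?N" if "j < n" for j
    proof -
      have "i * n + j < Suc i * n" using that by simp
      also have "\<dots> \<le> ?N" using \<open>i < length Ms\<close> by (intro mult_le_mono1) auto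
      finally show ?thesis .
    qed
    then show ?thesis by (intro eq_vecI) (auto simp: vec_block_def b_def add.assoc)
  qed
  have T: "(diag_block_mat (X # Ms))\<^sup>T
      = four_block_mat (X\<^sup>T) (0\<^sub>m (dim_col X) ?N) (0\<^sub>m (dim_col ?B) n) (?B\<^sup>T)"
  proof -
    have "diag_block_mat (X # Ms) = four_block_mat X (0\<^sub>m n (dim_col ?B)) (0\<^sub>m ?N (dim_col X)) ?B"
      using Cons.prems(1)[of X] rowB by (simp add: Let_def)
    then show ?thesis
      using transpose_four_block_mat[OF X zero_carrier_mat zero_carrier_mat B] by simp
  qed
  have prod: "(diag_block_mat (X # Ms))\<^sup>T *\<^sub>v v = (X\<^sup>T *\<^sub>v a) @\<^sub>v (?B\<^sup>T *\<^sub>v b)"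
    unfolding T vab
    by (rule four_block_diag_mult_vec) (use X B ab in \<open>simp_all only: transpose_carrier_mat\<close>)
  have zero: "0\<^sub>v (dim_col (diag_block_mat (X # Ms)))
      = 0\<^sub>v (dim_col X) @\<^sub>v (0\<^sub>v (dim_col ?B) :: 'a vec)"
    by (auto simp: Let_def)
  have "(diag_block_mat (X # Ms))\<^sup>T *\<^sub>v v = 0\<^sub>v (dim_col (diag_block_mat (X # Ms))) \<longleftrightarrow>
      X\<^sup>T *\<^sub>v a = 0\<^sub>v (dim_col X) \<and> ?B\<^sup>T *\<^sub>v b = 0\<^sub>v (dim_col ?B)"
  proof -
    have "X\<^sup>T *\<^sub>v a \<in> carrier_vec (dim_col X)" by (rule carrier_vecI) simp
    then show ?thesis unfolding prod zero by (rule append_vec_eq) (rule zero_carrier_vec)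
  qed
  also have "?B\<^sup>T *\<^sub>v b = 0\<^sub>v (dim_col ?B) \<longleftrightarrow>
      (\<forall>i<length Ms. (Ms ! i)\<^sup>T *\<^sub>v vec_block n b i = 0\<^sub>v (dim_col (Ms ! i)))"
    using Cons.prems ab by (intro Cons.IH) auto
  finally show ?case by (simp add: a_def block All_less_Suc2)
qed

text \<open>The Kronecker product with the all-ones column stacks \<open>r\<close> copies of
  \<open>K\<close>; its transpose applies \<open>K\<^sup>T\<close> to each block of \<open>v\<close>
  and adds the results.\<close>

lemma transpose_kronecker_ones_mult_vec:
  fixes K :: "'a :: comm_ring_1 mat"
  assumes K: "K \<in> carrier_mat n q" and v: "v \<in> carrier_vec (r * n)"
  shows "(kronecker_mat (ones_col r) K)\<^sup>T *\<^sub>v v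
    = K\<^sup>T *\<^sub>v finsum_vec TYPE('a) n (vec_block n v) {..<r}"
proof (rule eq_vecI)
  let ?f = "finsum_vec TYPE('a) n (vec_block n v) {..<r}"
  have f: "?f \<in> carrier_vec n" by (rule finsum_vec_carrier) auto
  fix j assume "j < dim_vec (K\<^sup>T *\<^sub>v ?f)"
  then have j: "j < q" using K by simp
  have "((kronecker_mat (ones_col r) K)\<^sup>T *\<^sub>v v) $ j = (\<Sum>x<r * n. K $$ (x mod n, j) * v $ x)"
  proof -
    have "x div n < r" if "x < r * n" for x using that by (simp add: less_mult_imp_div_less)
    then show ?thesis using K v j
      by (auto simp: kronecker_mat_def ones_col_def scalar_prod_def atLeast0LessThan intro!: sum.cong)
  qed
  \<comment> \<open>The indices below \<open>r * n\<close> are grouped by their quotient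
    \<open>i\<close> modulo \<open>n\<close>-blocks; inside a group the remainder is the row index
    of \<open>K\<close>.\<close>
  also have "\<dots> = (\<Sum>i<r. \<Sum>x = i * n..<i * n + n. K $$ (x mod n, j) * v $ x)"
    by (simp add: sum.nat_group)
  also have "\<dots> = (\<Sum>i<r. \<Sum>a<n. K $$ (a, j) * v $ (i * n + a))"
  proof (rule sum.cong[OF refl])
    fix i
    have "(\<Sum>x = i * n..<i * n + n. K $$ (x mod n, j) * v $ x)
        = (\<Sum>a = 0..<n. K $$ ((i * n + a) mod n, j) * v $ (i * n + a))"
      using sum.atLeastLessThan_shift_0[of "\<lambda>x. K $$ (x mod n, j) * v $ x" "i * n" "i * n + n"]
      by simp
    also have "\<dots> = (\<Sum>a<n. K $$ (a, j) * v $ (i * n + a))"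
      by (intro sum.cong) auto
    finally show "(\<Sum>x = i * n..<i * n + n. K $$ (x mod n, j) * v $ x)
        = (\<Sum>a<n. K $$ (a, j) * v $ (i * n + a))" .
  qed
  also have "\<dots> = (\<Sum>a<n. K $$ (a, j) * (\<Sum>i<r. v $ (i * n + a)))"
    by (subst sum.swap) (simp add: sum_distrib_left)
  also have "\<dots> = (\<Sum>a<n. K $$ (a, j) * ?f $ a)"
  proof (rule sum.cong[OF refl])
    fix a assume "a \<in> {..<n}"
    then show "K $$ (a, j) * (\<Sum>i<r. v $ (i * n + a)) = K $$ (a, j) * ?f $ a"
      by (subst index_finsum_vec) (auto simp: vec_block_def)
  qed
  also have "\<dots> = (K\<^sup>T *\<^sub>v ?f) $ j"
    using K f j by (simp add: scalar_prod_def atLeast0LessThan)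
  finally show "((kronecker_mat (ones_col r) K)\<^sup>T *\<^sub>v v) $ j = (K\<^sup>T *\<^sub>v ?f) $ j" .
qed (use K in \<open>simp add: kronecker_mat_def ones_col_def\<close>)

section \<open>The equivalences\<close>

lemma minus_mult_scalar_one_mat_vec:
  fixes M :: "'a :: comm_ring_1 mat"
  assumes "M \<in> carrier_mat n n" and "x \<in> carrier_vec n"
  shows "(M - l \<cdot>\<^sub>m 1\<^sub>m n) *\<^sub>v x = M *\<^sub>v x - l \<cdot>\<^sub>v x"
    and "(l \<cdot>\<^sub>m 1\<^sub>m n - M) *\<^sub>v x = l \<cdot>\<^sub>v x - M *\<^sub>v x"
proof -
  have "(l \<cdot>\<^sub>m 1\<^sub>m n) *\<^sub>v x = l \<cdot>\<^sub>v x"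
    using assms by (auto simp: smult_scalar_prod_distrib[of _ n] intro!: eq_vecI)
  then show "(M - l \<cdot>\<^sub>m 1\<^sub>m n) *\<^sub>v x = M *\<^sub>v x - l \<cdot>\<^sub>v x"
    and "(l \<cdot>\<^sub>m 1\<^sub>m n - M) *\<^sub>v x = l \<cdot>\<^sub>v x - M *\<^sub>v x"
    using assms by (simp_all add: minus_mult_distrib_mat_vec[of _ n n])
qed

lemma mem_mat_kernel_shift_iff:
  fixes M :: "'a :: comm_ring_1 mat"
  assumes M: "M \<in> carrier_mat n n"
  shows "x \<in> mat_kernel (l \<cdot>\<^sub>m 1\<^sub>m n - M) \<longleftrightarrow> x \<in> carrier_vec n \<and> M *\<^sub>v x = l \<cdot>\<^sub>v x"
proof -
  have "l \<cdot>\<^sub>v x - M *\<^sub>v x = 0\<^sub>v n \<longleftrightarrow> M *\<^sub>v x = l \<cdot>\<^sub>v x" if "x \<in> carrier_vec n"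
    using M that by (auto simp: vec_eq_iff)
  then show ?thesis using M minus_mult_scalar_one_mat_vec(2)[OF M] by (auto simp: mat_kernel_def)
qed

text \<open>The list \<open>[x0, x1]\<close> is itself a chain, of the shortest length that counts
  as non-trivial. Here the chain alternative of the peeling argument meets the assumption on the
  chain space.\<close>

lemma nontrivial_chain_spaceI:
  fixes M :: "'a :: field mat"
  assumes M: "M \<in> carrier_mat n n" and x: "x0 \<in> carrier_vec n" "x1 \<in> carrier_vec n" "x0 \<noteq> 0\<^sub>v n"
    and "M *\<^sub>v x0 = l \<cdot>\<^sub>v x0" and "M *\<^sub>v x1 - l \<cdot>\<^sub>v x1 = x0"
  shows "x0 \<in> nontrivial_chain_space M"
proof -
  interpret vec_space "TYPE('a)" n .
  let ?S = "{vs ! 0 | vs. \<exists>l. jordan_chain M l vs \<and> length vs \<ge> 2}"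
  have "jordan_chain M l [x0, x1]"
    using assms by (auto simp: jordan_chain_def eigenvector_def minus_mult_scalar_one_mat_vec nth_Cons')
  then have "x0 \<in> ?S" by (force intro!: exI[of _ "[x0, x1]"])
  moreover have "?S \<subseteq> carrier_vec n" using M by (auto simp: jordan_chain_def eigenvector_def)
  ultimately have "x0 \<in> span ?S" using in_own_span[of ?S] by (auto simp only: module_vec_simps)
  then show ?thesis using M by (simp add: nontrivial_chain_space_def)
qed

lemma zero_in_subspace_sum:
  fixes U :: "'i \<Rightarrow> 'a :: field vec set"
  assumes "finite I" and "\<And>i. i \<in> I \<Longrightarrow> 0\<^sub>v n \<in> U i"
  shows "0\<^sub>v n \<in> subspace_sum n I U"
proof -
  have "0\<^sub>v n = finsum_vec TYPE('a) n (\<lambda>i. 0\<^sub>v n) I"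
    using assms by (intro finsum_vec_eqI) auto
  then show ?thesis using assms unfolding subspace_sum_def by blast
qed

text \<open>Powers of \<open>M\<close> only rescale the summands of a sum of eigenvectors killed by
  \<open>D\<close>, so \<open>D\<close> kills their images too; this gives one direction. For the
  other, \<open>shifted_prod_eq_0_cases\<close> places \<open>R z\<close> in the sum once chains are
  excluded. With the transposes of \<open>A\<close>, \<open>B\<close>, \<open>C\<close> for
  \<open>M\<close>, \<open>D\<close>, \<open>R\<close> this is the equivalence of (i) and
  (ii).\<close>

lemma mat_range_inter_subspace_sum_eq_0_iff:
  fixes M D R :: "complex mat"
  assumes M: "M \<in> carrier_mat n n" and D: "D \<in> carrier_mat m n" and R: "R \<in> carrier_mat n p"
    and inj: "\<And>z. z \<in> carrier_vec p \<Longrightarrow> R *\<^sub>v z = 0\<^sub>v n \<Longrightarrow> z = 0\<^sub>v p"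
    and ls: "distinct ls" and ev: "\<And>l. eigenvalue M l \<Longrightarrow> l \<in> set ls"
    and chains: "nontrivial_chain_space M \<inter> mat_kernel D \<subseteq> mat_range R"
  defines "E \<equiv> \<lambda>i. mat_kernel (ls ! i \<cdot>\<^sub>m 1\<^sub>m n - M) \<inter> mat_kernel D"
  shows "(\<forall>z\<in>carrier_vec p. (\<forall>k<n. D *\<^sub>v ((M ^\<^sub>m k) *\<^sub>v (R *\<^sub>v z)) = 0\<^sub>v m) \<longrightarrow> z = 0\<^sub>v p) \<longleftrightarrow>
    mat_range R \<inter> subspace_sum n {..<length ls} E = {0\<^sub>v n}"
    (is "?obs \<longleftrightarrow> ?R \<inter> ?S = _")
proof
  have E: "x \<in> E i \<longleftrightarrow> x \<in> carrier_vec n \<and> M *\<^sub>v x = ls ! i \<cdot>\<^sub>v x \<and> D *\<^sub>v x = 0\<^sub>v m" for x i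
    using D mem_mat_kernel_shift_iff[OF M] by (auto simp: E_def mat_kernel_def)
  have E0: "0\<^sub>v n \<in> E i" for i using M D by (auto simp: E mult_mat_zero_vec smult_zero_vec)
  have R0: "0\<^sub>v n \<in> ?R" using R mult_mat_zero_vec[OF R] by (auto simp: mat_range_def intro!: image_eqI[of _ _ "0\<^sub>v p"])
  have S0: "0\<^sub>v n \<in> ?S" using E0 by (intro zero_in_subspace_sum) auto
  {
    assume obs: ?obs
    have "v = 0\<^sub>v n" if v: "v \<in> ?R" "v \<in> ?S" for v
    proof -
      obtain z where z: "z \<in> carrier_vec p" "v = R *\<^sub>v z" using v R by (auto simp: mat_range_def)
      obtain w where w: "w \<in> Pi {..<length ls} E" and vw: "v = finsum_vec TYPE(complex) n w {..<length ls}"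
        using v by (auto simp: subspace_sum_def)
      have wE: "w i \<in> carrier_vec n" "M *\<^sub>v w i = ls ! i \<cdot>\<^sub>v w i" "D *\<^sub>v w i = 0\<^sub>v m"
        if "i < length ls" for i using w that E[of "w i" i] by auto
      have "D *\<^sub>v ((M ^\<^sub>m k) *\<^sub>v v) = 0\<^sub>v m" for k
      proof -
        have pow: "M ^\<^sub>m k \<in> carrier_mat n n" using M by simp
        have Mw: "D *\<^sub>v ((M ^\<^sub>m k) *\<^sub>v w i) = 0\<^sub>v m" if "i < length ls" for i
        proof -
          have "(M ^\<^sub>m k) *\<^sub>v w i = (ls ! i) ^ k \<cdot>\<^sub>v w i"
          proof (cases "w i = 0\<^sub>v n")
            case True
            then show ?thesis using mult_mat_zero_vec[OF pow] by (simp add: smult_zero_vec)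
          next
            case False
            then show ?thesis using eigenvector_pow[OF M] wE[OF that] M by (auto simp: eigenvector_def)
          qed
          then have "D *\<^sub>v ((M ^\<^sub>m k) *\<^sub>v w i) = (ls ! i) ^ k \<cdot>\<^sub>v 0\<^sub>v m"
            using mult_mat_vec[OF D wE(1)[OF that]] wE(3)[OF that] by simp
          then show ?thesis by (simp add: smult_zero_vec)
        qed
        have DM: "D * M ^\<^sub>m k \<in> carrier_mat m n" using D pow by simp
        have "(D * M ^\<^sub>m k) *\<^sub>v v = finsum_vec TYPE(complex) m (\<lambda>i. (D * M ^\<^sub>m k) *\<^sub>v w i) {..<length ls}"
          unfolding vw using wE by (intro mult_mat_finsum_vec[OF DM]) auto
        also have "\<dots> = 0\<^sub>v m"
          using wE D pow by (intro finsum_vec_eqI[symmetric]) (auto simp: Mw)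
        finally show ?thesis using z R D pow by simp
      qed
      then have "z = 0\<^sub>v p" using obs z by blast
      then show ?thesis using z mult_mat_zero_vec[OF R] by simp
    qed
    then show "?R \<inter> ?S = {0\<^sub>v n}" using R0 S0 by blast
  }
  {
    assume 0: "?R \<inter> ?S = {0\<^sub>v n}"
    obtain \<mu>s where \<mu>s: "length \<mu>s = n" "\<And>v. v \<in> carrier_vec n \<Longrightarrow> shifted_prod M \<mu>s v = 0\<^sub>v n"
      using exists_annihilating_shifted_prod[OF M] by blast
    \<comment> \<open>The bottom \<open>x0\<close> of such a chain lies in \<open>?R\<close> by
      \<open>chains\<close>, and in \<open>?S\<close> through the family concentrated at index
      \<open>i\<close>; so the intersection would contain a nonzero vector.\<close>
    have no_chain: False if "i < length ls" "x0 \<in> E i" "x0 \<noteq> 0\<^sub>v n" "x1 \<in> carrier_vec n"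
      "M *\<^sub>v x1 - ls ! i \<cdot>\<^sub>v x1 = x0" for i x0 x1
    proof -
      have "x0 \<in> nontrivial_chain_space M"
        using nontrivial_chain_spaceI[OF M] that E by blast
      then have "x0 \<in> ?R" using chains that(2) by (auto simp: E_def)
      moreover have "(\<lambda>j. if j = i then x0 else 0\<^sub>v n) \<in> Pi {..<length ls} E"
        using that E0 by auto
      moreover have "x0 = finsum_vec TYPE(complex) n (\<lambda>j. if j = i then x0 else 0\<^sub>v n) {..<length ls}"
      proof (rule finsum_vec_eqI)
        fix k assume "k < n"
        then have "(\<Sum>j<length ls. (if j = i then x0 else 0\<^sub>v n) $ k) = (\<Sum>j<length ls. if j = i then x0 $ k else 0)"
          by (intro sum.cong) auto
        then show "x0 $ k = (\<Sum>j<length ls. (if j = i then x0 else 0\<^sub>v n) $ k)" using that(1) by simp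
      qed (use that E in auto)
      ultimately have "x0 \<in> ?R \<inter> ?S" unfolding subspace_sum_def by blast
      then show False using 0 that(3) by auto
    qed
    show ?obs
    proof (intro ballI impI)
      fix z assume z: "z \<in> carrier_vec p" and k: "\<forall>k<n. D *\<^sub>v ((M ^\<^sub>m k) *\<^sub>v (R *\<^sub>v z)) = 0\<^sub>v m"
      have Rz: "R *\<^sub>v z \<in> carrier_vec n" using R z by simp
      \<comment> \<open>The list of factors has length \<open>n\<close>, so the powers
        \<open>k < n\<close> are exactly those required.\<close>
      have "R *\<^sub>v z \<in> ?S"
        using shifted_prod_eq_0_cases[OF M D ls ev E Rz \<mu>s(2)[OF Rz]] k \<mu>s(1) no_chain by blast
      moreover have "R *\<^sub>v z \<in> ?R" using R z by (auto simp: mat_range_def)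
      ultimately show "z = 0\<^sub>v p" using 0 inj z by blast
    qed
  }
qed

text \<open>A left null vector is cut into one block per entry of \<open>ls\<close>: the diagonal
  part forces block \<open>i\<close> into \<open>E i\<close>, and the Kronecker part forces the sum
  of the blocks into the kernel of \<open>K\<^sup>T\<close>. Independence of eigenspaces lets this
  sum stand for the whole vector.\<close>

lemma full_row_rank_eigenvalue_block_mat_iff:
  fixes A B K :: "'a :: field mat"
  assumes A: "A \<in> carrier_mat n n" and B: "B \<in> carrier_mat n m" and K: "K \<in> carrier_mat n q"
    and ls: "distinct ls"
  defines "E \<equiv> \<lambda>i. mat_kernel (ls ! i \<cdot>\<^sub>m 1\<^sub>m n - A\<^sup>T) \<inter> mat_kernel (B\<^sup>T)"
  shows "full_row_rank (block_row (length ls * n)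
      [diag_block_mat (map (\<lambda>l. block_row n [l \<cdot>\<^sub>m 1\<^sub>m n - A, B]) ls), kronecker_mat (ones_col (length ls)) K])
    \<longleftrightarrow> {x \<in> carrier_vec n. K\<^sup>T *\<^sub>v x = 0\<^sub>v q} \<inter> subspace_sum n {..<length ls} E = {0\<^sub>v n}"
proof -
  let ?r = "length ls"
  let ?X = "\<lambda>l. block_row n [l \<cdot>\<^sub>m 1\<^sub>m n - A, B]"
  let ?G = "diag_block_mat (map ?X ls)"
  let ?H = "kronecker_mat (ones_col ?r) K"
  have At: "A\<^sup>T \<in> carrier_mat n n" using A by simp
  have E: "x \<in> E i \<longleftrightarrow> x \<in> carrier_vec n \<and> (ls ! i \<cdot>\<^sub>m 1\<^sub>m n - A\<^sup>T) *\<^sub>v x = 0\<^sub>v n \<and> B\<^sup>T *\<^sub>v x = 0\<^sub>v m" for x i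
    using A B by (auto simp: E_def mat_kernel_def)
  have Ec: "w \<in> {..<?r} \<rightarrow> carrier_vec n" if "w \<in> Pi {..<?r} E" for w
    using that E by (auto simp: Pi_def)
  \<comment> \<open>The Popov-Belevitch-Hautus test: left null vectors of the pencil block are the
    eigenvectors of \<open>A\<^sup>T\<close> killed by \<open>B\<^sup>T\<close>, together with
    zero.\<close>
  have X: "(?X (ls ! i))\<^sup>T *\<^sub>v x = 0\<^sub>v (dim_col (?X (ls ! i))) \<longleftrightarrow> x \<in> E i" if "x \<in> carrier_vec n" for x i
  proof -
    have "(ls ! i \<cdot>\<^sub>m 1\<^sub>m n - A)\<^sup>T = ls ! i \<cdot>\<^sub>m 1\<^sub>m n - A\<^sup>T"
      using A by (intro eq_matI) auto
    moreover have dims: "dim_row Y = n" if "Y \<in> set [ls ! i \<cdot>\<^sub>m 1\<^sub>m n - A, B]" for Y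
      using that A B by auto
    ultimately show ?thesis
      using transpose_block_row_mult_eq_0_iff[OF dims, of "[ls ! i \<cdot>\<^sub>m 1\<^sub>m n - A, B]" x] that A B
      by (simp add: E)
  qed
  have rowX: "dim_row (?X l) = n" for l by (simp add: block_row_def)
  have rowG: "dim_row ?G = ?r * n"
    by (simp only: dim_diag_block_mat map_map comp_def rowX sum_list_triv) simp
  have rowH: "dim_row ?H = ?r * n" and colH: "dim_col ?H = q"
    using K by (simp_all add: kronecker_mat_def ones_col_def)
  have E0: "0\<^sub>v n \<in> E i" for i using A B by (auto simp: E intro!: mult_mat_zero_vec)
  define s where "s w = finsum_vec TYPE('a) n w {..<?r}" for w
  have kernel: "((block_row (?r * n) [?G, ?H])\<^sup>T *\<^sub>v v = 0\<^sub>v (dim_col (block_row (?r * n) [?G, ?H])))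
      \<longleftrightarrow> vec_block n v \<in> Pi {..<?r} E \<and> K\<^sup>T *\<^sub>v s (vec_block n v) = 0\<^sub>v q"
    if v: "v \<in> carrier_vec (?r * n)" for v
  proof -
    have "(?G\<^sup>T *\<^sub>v v = 0\<^sub>v (dim_col ?G)) \<longleftrightarrow> (\<forall>i<?r. vec_block n v i \<in> E i)"
    proof -
      have "(?G\<^sup>T *\<^sub>v v = 0\<^sub>v (dim_col ?G)) \<longleftrightarrow>
          (\<forall>i<length (map ?X ls). (map ?X ls ! i)\<^sup>T *\<^sub>v vec_block n v i = 0\<^sub>v (dim_col (map ?X ls ! i)))"
        using v by (intro transpose_diag_block_mat_mult_eq_0_iff) (auto simp: rowX)
      then show ?thesis using X by simp
    qed
    moreover have "?H\<^sup>T *\<^sub>v v = K\<^sup>T *\<^sub>v s (vec_block n v)"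
      unfolding s_def using K v by (rule transpose_kronecker_ones_mult_vec)
    ultimately show ?thesis
      using transpose_block_row_mult_eq_0_iff[of "[?G, ?H]" "?r * n" v] rowG rowH colH
      by (auto simp: Pi_iff)
  qed
  have "full_row_rank (block_row (?r * n) [?G, ?H]) \<longleftrightarrow>
      (\<forall>v\<in>carrier_vec (?r * n). vec_block n v \<in> Pi {..<?r} E \<and> K\<^sup>T *\<^sub>v s (vec_block n v) = 0\<^sub>v q
        \<longrightarrow> v = 0\<^sub>v (?r * n))"
  proof -
    have Z: "block_row (?r * n) [?G, ?H] \<in> carrier_mat (?r * n) (dim_col (block_row (?r * n) [?G, ?H]))"
      by (rule carrier_matI) (simp_all only: block_row_def mat_of_cols_carrier)
    show ?thesis unfolding full_row_rank_iff[OF Z] using kernel by blast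
  qed
  \<comment> \<open>Vectors of length \<open>?r * n\<close> are traded for families of blocks: one
    direction stacks a family into a vector, the other uses independence to pass from a zero sum to
    zero blocks.\<close>
  also have "\<dots> \<longleftrightarrow> (\<forall>w\<in>Pi {..<?r} E. K\<^sup>T *\<^sub>v s w = 0\<^sub>v q \<longrightarrow> s w = 0\<^sub>v n)" (is "?L \<longleftrightarrow> ?Rt")
  proof
    assume L: ?L
    show ?Rt
    proof (intro ballI impI)
      fix w assume w: "w \<in> Pi {..<?r} E" and 0: "K\<^sup>T *\<^sub>v s w = 0\<^sub>v q"
      define v where "v = vec (?r * n) (\<lambda>x. w (x div n) $ (x mod n))"
      have block: "vec_block n v i = w i" if i: "i < ?r" for i
      proof (rule eq_vecI)
        have wi: "w i \<in> carrier_vec n" using Ec[OF w] i by auto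
        then show "dim_vec (vec_block n v i) = dim_vec (w i)" by (simp add: vec_block_def)
        fix a assume "a < dim_vec (w i)"
        then have a: "a < n" using wi by simp
        have "i * n + a < Suc i * n" using a by simp
        also have "\<dots> \<le> ?r * n" using i by (intro mult_le_mono1) auto
        finally show "vec_block n v i $ a = w i $ a" using a by (simp add: vec_block_def v_def)
      qed
      \<comment> \<open>The families agree on the indices below \<open>?r\<close>, the only ones
        that enter the sum.\<close>
      have "s (vec_block n v) = s w"
        unfolding s_def
      proof (rule finsum_vec_eqI)
        fix k assume "k < n"
        then have "finsum_vec TYPE('a) n (vec_block n v) {..<?r} $ k = (\<Sum>i<?r. vec_block n v i $ k)"
          by (intro index_finsum_vec) auto
        then show "finsum_vec TYPE('a) n (vec_block n v) {..<?r} $ k = (\<Sum>i<?r. w i $ k)"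
          using block by simp
      qed (use Ec[OF w] in \<open>auto intro: finsum_vec_carrier\<close>)
      moreover have "vec_block n v \<in> Pi {..<?r} E" using w block by auto
      ultimately have "v = 0\<^sub>v (?r * n)" using L 0 by (auto simp: v_def)
      have "w i = 0\<^sub>v n" if i: "i < ?r" for i
      proof -
        have "vec_block n v i = 0\<^sub>v n"
        proof (rule eq_vecI)
          fix a assume "a < dim_vec (0\<^sub>v n :: 'a vec)"
          then have "i * n + a < Suc i * n" by simp
          also have "\<dots> \<le> ?r * n" using i by (intro mult_le_mono1) auto
          finally show "vec_block n v i $ a = 0\<^sub>v n $ a"
            using \<open>v = 0\<^sub>v (?r * n)\<close> \<open>a < dim_vec _\<close> by (simp add: vec_block_def)
        qed (simp add: vec_block_def)
        then show ?thesis using block[OF i] by simp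
      qed
      then show "s w = 0\<^sub>v n" unfolding s_def by (intro finsum_vec_eqI[symmetric]) auto
    qed
  next
    assume Rt: ?Rt
    show ?L
    proof (intro ballI impI)
      fix v :: "'a vec" assume v: "v \<in> carrier_vec (?r * n)"
        and *: "vec_block n v \<in> Pi {..<?r} E \<and> K\<^sup>T *\<^sub>v s (vec_block n v) = 0\<^sub>v q"
      then have s0: "finsum_vec TYPE('a) n (vec_block n v) {..<?r} = 0\<^sub>v n"
        using Rt unfolding s_def by blast
      have b0: "vec_block n v i = 0\<^sub>v n" if "i < ?r" for i
      proof (rule eigenspaces_independent[of "{..<?r}" "A\<^sup>T" n "\<lambda>i. ls ! i" E "vec_block n v" i])
        show "inj_on (\<lambda>i. ls ! i) {..<?r}" using ls by (auto simp: inj_on_def nth_eq_iff_index_eq)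
      qed (use At * s0 that in \<open>auto simp: E_def\<close>)
      show "v = 0\<^sub>v (?r * n)"
      proof (rule eq_vecI)
        fix x assume "x < dim_vec (0\<^sub>v (?r * n) :: 'a vec)"
        then have x: "x < ?r * n" by simp
        \<comment> \<open>An index below \<open>?r * n\<close> exists, which excludes
          \<open>n = 0\<close> and makes quotient and remainder by \<open>n\<close> valid block
          coordinates.\<close>
        then have "n > 0" by (cases n) auto
        have "vec_block n v (x div n) $ (x mod n) = 0"
          using b0[of "x div n"] x \<open>n > 0\<close> by (simp add: less_mult_imp_div_less)
        then show "v $ x = 0\<^sub>v (?r * n) $ x" using x \<open>n > 0\<close> by (simp add: vec_block_def)
      qed (use v in simp)
    qed
  qed
  also have "\<dots> \<longleftrightarrow> {x \<in> carrier_vec n. K\<^sup>T *\<^sub>v x = 0\<^sub>v q} \<inter> subspace_sum n {..<?r} E = {0\<^sub>v n}"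
  proof -
    let ?S = "subspace_sum n {..<?r} E"
    have S: "?S = s ` Pi {..<?r} E" by (auto simp: subspace_sum_def s_def)
    have "0\<^sub>v n \<in> ?S" using E0 by (intro zero_in_subspace_sum) auto
    moreover have "K\<^sup>T *\<^sub>v 0\<^sub>v n = 0\<^sub>v q" using K by (intro mult_mat_zero_vec) simp
    moreover have "?S \<subseteq> carrier_vec n"
      unfolding S s_def using finsum_vec_carrier[OF Ec] by blast
    ultimately have "{x \<in> carrier_vec n. K\<^sup>T *\<^sub>v x = 0\<^sub>v q} \<inter> ?S = {0\<^sub>v n} \<longleftrightarrow>
        (\<forall>x\<in>?S. K\<^sup>T *\<^sub>v x = 0\<^sub>v q \<longrightarrow> x = 0\<^sub>v n)" by blast
    then show ?thesis by (simp only: S ball_simps)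
  qed
  finally show ?thesis .
qed

theorem theorem4:
  fixes A B C :: "real mat" and n m p :: nat and ls :: "complex list"
  assumes "A \<in> carrier_mat n n" and "B \<in> carrier_mat n m" and "C \<in> carrier_mat p n"
    and "p < n" and "full_row_rank C"
    and "distinct ls" and "set ls = spectrum (cmat A)"
    and "nontrivial_chain_space ((cmat A)\<^sup>T) \<inter> mat_kernel ((cmat B)\<^sup>T)
           \<subseteq> mat_range ((cmat C)\<^sup>T)"
  shows "(output_controllable A B C \<longleftrightarrow>
            mat_range ((cmat C)\<^sup>T) \<inter>
              subspace_sum n {..<length ls}
                (\<lambda>i. mat_kernel (ls ! i \<cdot>\<^sub>m 1\<^sub>m n - (cmat A)\<^sup>T) \<inter> mat_kernel ((cmat B)\<^sup>T))
            = {0\<^sub>v n}) \<and>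
         (\<forall>K \<in> carrier_mat n (n - p). mat_range K = mat_kernel C \<longrightarrow>
           (output_controllable A B C \<longleftrightarrow>
              full_row_rank
                (block_row (length ls * n)
                  [diag_block_mat
                     (map (\<lambda>l. block_row n [l \<cdot>\<^sub>m 1\<^sub>m n - cmat A, cmat B]) ls),
                   kronecker_mat (ones_col (length ls)) (cmat K)])))"
proof -
  note A = assms(1) and B = assms(2) and C = assms(3)
  have cA: "cmat A \<in> carrier_mat n n" and cB: "cmat B \<in> carrier_mat n m"
    and cC: "cmat C \<in> carrier_mat p n" using A B C by auto
  have cAt: "(cmat A)\<^sup>T \<in> carrier_mat n n" and cBt: "(cmat B)\<^sup>T \<in> carrier_mat m n"
    and cCt: "(cmat C)\<^sup>T \<in> carrier_mat n p" using A B C by auto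
  \<comment> \<open>Full row rank of the real matrix \<open>C\<close> makes its transpose injective
    on complex vectors, through real and imaginary parts.\<close>
  have inj: "z = 0\<^sub>v p" if z: "z \<in> carrier_vec p" and 0: "(cmat C)\<^sup>T *\<^sub>v z = 0\<^sub>v n" for z
  proof -
    have Ct: "C\<^sup>T \<in> carrier_mat n p" using C by simp
    have "cmat (C\<^sup>T) *\<^sub>v z = 0\<^sub>v n" using 0 by (simp add: map_mat_transpose)
    then have "map_vec Re z = 0\<^sub>v p" "map_vec Im z = 0\<^sub>v p"
      using z assms(5) full_row_rank_iff[OF C] cmat_mult_vec_eq_0_iff[OF Ct z] by auto
    then show ?thesis by (intro complex_vec_eqI) (auto simp: vec_eq_iff)
  qed
  \<comment> \<open>A matrix and its transpose have the same characteristic polynomial, so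
    \<open>ls\<close> also lists the eigenvalues of the transpose.\<close>
  have ev: "l \<in> set ls" if "eigenvalue ((cmat A)\<^sup>T) l" for l
    using that assms(7) eigenvalue_root_char_poly[OF cA] eigenvalue_root_char_poly[OF cAt]
      char_poly_transpose_mat[OF cA] by (simp add: spectrum_def)
  have OC: "output_controllable A B C \<longleftrightarrow>
      mat_range ((cmat C)\<^sup>T) \<inter> subspace_sum n {..<length ls}
        (\<lambda>i. mat_kernel (ls ! i \<cdot>\<^sub>m 1\<^sub>m n - (cmat A)\<^sup>T) \<inter> mat_kernel ((cmat B)\<^sup>T)) = {0\<^sub>v n}"
    unfolding output_controllable_iff[OF A B C]
    by (rule mat_range_inter_subspace_sum_eq_0_iff[OF cAt cBt cCt inj assms(6) ev assms(8)])
  moreover have "output_controllable A B C \<longleftrightarrow>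
      full_row_rank (block_row (length ls * n)
        [diag_block_mat (map (\<lambda>l. block_row n [l \<cdot>\<^sub>m 1\<^sub>m n - cmat A, cmat B]) ls),
         kronecker_mat (ones_col (length ls)) (cmat K)])"
    if K: "K \<in> carrier_mat n (n - p)" and CK: "mat_range K = mat_kernel C" for K
  proof -
    have cK: "cmat K \<in> carrier_mat n (n - p)" using K by simp
    \<comment> \<open>Both sides become the same intersection once the image of the transpose of
      \<open>cmat C\<close> is rewritten as the kernel of the transpose of
      \<open>cmat K\<close>.\<close>
    show ?thesis
      unfolding OC full_row_rank_eigenvalue_block_mat_iff[OF cA cB cK assms(6)]
        mat_range_transpose_eq_kernel_transpose[OF cC cK mat_kernel_cmat_eq_mat_range[OF C K CK]] ..
  qed
  ultimately show ?thesis by blast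
qed

end
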